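(* Let $\mathbb{F}$ be a field and let $P$ be an algebraic branching program (ABP) of size $s$ and depth $d$ over $\mathbb{F}\{x_1,\ldots,x_n\}$, given by black-box access that allows evaluation of the polynomial computed at any gate (vertex) of $P$ for inputs $x_i$ chosen from a matrix algebra $M_k(\mathbb{F})$ for a polynomially bounded value of $k$. Then in deterministic time $\mathrm{poly}(d,s,n)$ one can compute an ABP $P'$ that computes the same polynomial as $P$.
   Context: $\mathbb{F}\{x_1,\ldots,x_n\}$ is the ring of polynomials in noncommuting variables over $\mathbb{F}$, and $M_k(\mathbb{F})$ is the algebra of $k\times k$ matrices over $\mathbb{F}$. An algebraic branching program is a directed acyclic graph with one vertex of in-degree zero (the source) and one vertex of out-degree zero (the sink), whose vertices are partitioned into levels $0,1,\ldots,d$, with edges only from level $i$ to level $i+1$, the source the only vertex of level $0$ and the sink the only vertex of level $d$; each edge is labeled by a homogeneous linear form $\sum_s a_s x_s$ in the variables. The polynomial computed at a vertex $v$ is the sum, over all source-to-$v$ paths, of the (ordered, noncommutative) product of the edge labels along the path; the ABP computes the polynomial at the sink. Its size is its number of vertices. Gates are indexed by level number and position within the level, and evaluating a gate on matrix inputs costs time polynomial in $k$. *)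

theory Defs
  imports
    "HOL-Library.Poly_Mapping"
    "HOL-Computational_Algebra.Polynomial"
    "Jordan_Normal_Form.Matrix"
    "Graph_Theory.Pair_Digraph"
begin

section \<open>Polynomials in noncommuting variables\<close>

text \<open>
  Monomials are words over the variables, multiplied by concatenation. With this monoid as the
  type of exponents, the multiplication of HOL-Library.Poly_Mapping is that of the free algebra.
  The variables \<open>x\<^sub>1, \<dots>, x\<^sub>n\<close> are numbered \<open>0, \<dots>, n - 1\<close>.
\<close>

datatype 'v ncmonom = Word (letters: "'v list")

instantiation ncmonom :: (type) monoid_add
begin

definition "0 = Word []"

definition "v + w = Word (letters v @ letters w)"

instance
  by standard (simp_all add: zero_ncmonom_def plus_ncmonom_def)

end

type_synonym 'a ncpoly = "nat ncmonom \<Rightarrow>\<^sub>0 'a"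

definition ncvar :: "nat \<Rightarrow> 'a::field ncpoly" where
  "ncvar t = Poly_Mapping.single (Word [t]) 1"

definition ncconst :: "'a::field \<Rightarrow> 'a ncpoly" where
  "ncconst a = Poly_Mapping.single 0 a"

text \<open>
  The value of a polynomial at \<open>k \<times> k\<close> matrices \<open>X t\<close>. The sum of matrices is written entrywise
  because the type of matrices of all sizes has no additive monoid structure.
\<close>

definition eval_word :: "nat \<Rightarrow> (nat \<Rightarrow> 'a::field mat) \<Rightarrow> nat ncmonom \<Rightarrow> 'a mat" where
  "eval_word k X w = foldr (\<lambda>t A. X t * A) (letters w) (1\<^sub>m k)"

definition eval_ncpoly :: "nat \<Rightarrow> (nat \<Rightarrow> 'a::field mat) \<Rightarrow> 'a ncpoly \<Rightarrow> 'a mat" where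
  "eval_ncpoly k X f =
     mat k k (\<lambda>(r, c). \<Sum>w\<in>Poly_Mapping.keys f. Poly_Mapping.lookup f w * eval_word k X w $$ (r, c))"


section \<open>Algebraic branching programs\<close>

text \<open>
  A vertex (gate) is a pair of its level and its position within the level, both counted from \<open>0\<close>.
  The label of an arc is given by its coefficients; only those of the first \<open>abp_nvars\<close> variables
  are used.
\<close>

record 'a abp =
  abp_nvars :: nat
  abp_depth :: nat
  abp_graph :: "(nat \<times> nat) pair_pre_digraph"
  abp_coeff :: "(nat \<times> nat) \<times> (nat \<times> nat) \<Rightarrow> nat \<Rightarrow> 'a"

text \<open>
  Acyclicity is implied, since every arc raises the level by one. A label may be the zero form.
\<close>

definition is_abp :: "'a::field abp \<Rightarrow> bool" where
  "is_abp P \<longleftrightarrow>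
     (let G = abp_graph P; d = abp_depth P in
        pair_fin_digraph G \<and>
        (\<exists>width. pverts G = {(i, j). i \<le> d \<and> j < width i}) \<and>
        (\<forall>(u, v)\<in>parcs G. fst v = Suc (fst u)) \<and>
        {v \<in> pverts G. in_degree (with_proj G) v = 0} = {(0, 0)} \<and>
        {v \<in> pverts G. out_degree (with_proj G) v = 0} = {(d, 0)} \<and>
        {v \<in> pverts G. fst v = 0} = {(0, 0)} \<and>
        {v \<in> pverts G. fst v = d} = {(d, 0)})"

definition abp_size :: "'a::field abp \<Rightarrow> nat" where
  "abp_size P = card (pverts (abp_graph P))"

definition abp_label :: "'a::field abp \<Rightarrow> (nat \<times> nat) \<times> (nat \<times> nat) \<Rightarrow> 'a ncpoly" where
  "abp_label P e = (\<Sum>t<abp_nvars P. ncconst (abp_coeff P e t) * ncvar t)"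

definition gate_poly :: "'a::field abp \<Rightarrow> nat \<times> nat \<Rightarrow> 'a ncpoly" where
  "gate_poly P v =
     (\<Sum>p | pre_digraph.apath (with_proj (abp_graph P)) (0, 0) p v. prod_list (map (abp_label P) p))"

definition abp_poly :: "'a::field abp \<Rightarrow> 'a ncpoly" where
  "abp_poly P = gate_poly P (abp_depth P, 0)"


section \<open>Black boxes\<close>

text \<open>
  A black box takes a level, a position, a dimension \<open>k\<close> and \<open>k \<times> k\<close> matrices for the variables.
  For a pair that is not a gate of \<open>P\<close> there is no path, so the answer is the zero matrix; a
  caller is not told which positions are occupied.
\<close>

type_synonym 'a blackbox = "nat \<Rightarrow> nat \<Rightarrow> nat \<Rightarrow> (nat \<Rightarrow> 'a mat) \<Rightarrow> 'a mat"

definition blackbox_of :: "'a::field abp \<Rightarrow> 'a blackbox" where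
  "blackbox_of P i j k X = eval_ncpoly k X (gate_poly P (i, j))"


section \<open>Deterministic algorithms over a field\<close>

text \<open>
  Algorithms are programs of a random access machine over a field, with one memory of natural
  numbers and one of field elements. Each memory consists of named arrays indexed by lists of
  numbers (the empty list for a simple variable). A program is a finite syntactic object that
  mentions neither the field nor the instance.

  Natural numbers are only added, subtracted (truncating at \<open>0\<close>) and compared. There is no
  multiplication, so a number reached after \<open>t\<close> unit-cost steps has only \<open>O(t)\<close> bits more than
  the inputs, and charging one unit per step is legitimate. On the field, the arithmetic
  operations and equality tests are available. Expressions contribute no more than a factor that
  depends on the program text alone, so they are not charged separately.
\<close>

type_synonym vname = string

datatype nexp =
    NConst nat
  | NVar vname "nexp list"
  | NPlus nexp nexp
  | NMinus nexp nexp

datatype fexp =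
    FZero
  | FOne
  | FVar vname "nexp list"
  | FPlus fexp fexp
  | FMinus fexp fexp
  | FTimes fexp fexp
  | FDivide fexp fexp

datatype bexp =
    NLess nexp nexp
  | NEq nexp nexp
  | FEq fexp fexp
  | BNot bexp
  | BAnd bexp bexp

datatype com =
    Skip
  | NAssign vname "nexp list" nexp
  | FAssign vname "nexp list" fexp
  | Seq com com
  | Cond bexp com com
  | While bexp com
  | Query vname nexp nexp nexp vname

record 'a state =
  nmem :: "vname \<Rightarrow> nat list \<Rightarrow> nat"
  fmem :: "vname \<Rightarrow> nat list \<Rightarrow> 'a"

fun nval :: "'a state \<Rightarrow> nexp \<Rightarrow> nat" where
  "nval \<sigma> (NConst m) = m"
| "nval \<sigma> (NVar x es) = nmem \<sigma> x (map (nval \<sigma>) es)"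
| "nval \<sigma> (NPlus a b) = nval \<sigma> a + nval \<sigma> b"
| "nval \<sigma> (NMinus a b) = nval \<sigma> a - nval \<sigma> b"

fun fval :: "'a::field state \<Rightarrow> fexp \<Rightarrow> 'a" where
  "fval \<sigma> FZero = 0"
| "fval \<sigma> FOne = 1"
| "fval \<sigma> (FVar x es) = fmem \<sigma> x (map (nval \<sigma>) es)"
| "fval \<sigma> (FPlus a b) = fval \<sigma> a + fval \<sigma> b"
| "fval \<sigma> (FMinus a b) = fval \<sigma> a - fval \<sigma> b"
| "fval \<sigma> (FTimes a b) = fval \<sigma> a * fval \<sigma> b"
| "fval \<sigma> (FDivide a b) = fval \<sigma> a / fval \<sigma> b"

fun bval :: "'a::field state \<Rightarrow> bexp \<Rightarrow> bool" where
  "bval \<sigma> (NLess a b) \<longleftrightarrow> nval \<sigma> a < nval \<sigma> b"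
| "bval \<sigma> (NEq a b) \<longleftrightarrow> nval \<sigma> a = nval \<sigma> b"
| "bval \<sigma> (FEq a b) \<longleftrightarrow> fval \<sigma> a = fval \<sigma> b"
| "bval \<sigma> (BNot b) \<longleftrightarrow> \<not> bval \<sigma> b"
| "bval \<sigma> (BAnd b c) \<longleftrightarrow> bval \<sigma> b \<and> bval \<sigma> c"

definition nupdate :: "vname \<Rightarrow> nat list \<Rightarrow> nat \<Rightarrow> 'a state \<Rightarrow> 'a state" where
  "nupdate x is m \<sigma> = \<sigma>\<lparr>nmem := (nmem \<sigma>)(x := (nmem \<sigma> x)(is := m))\<rparr>"

definition fupdate :: "vname \<Rightarrow> nat list \<Rightarrow> 'a \<Rightarrow> 'a state \<Rightarrow> 'a state" where
  "fupdate x is a \<sigma> = \<sigma>\<lparr>fmem := (fmem \<sigma>)(x := (fmem \<sigma> x)(is := a))\<rparr>"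

text \<open>Entry \<open>(r, c)\<close> of the \<open>t\<close>-th input matrix of a query is at index \<open>[t, r, c]\<close> of an array, and
  entry \<open>(r, c)\<close> of the answer goes to index \<open>[r, c]\<close>.\<close>

definition read_matrices :: "'a state \<Rightarrow> vname \<Rightarrow> nat \<Rightarrow> nat \<Rightarrow> 'a mat" where
  "read_matrices \<sigma> x k t = mat k k (\<lambda>(r, c). fmem \<sigma> x [t, r, c])"

definition write_matrix :: "vname \<Rightarrow> nat \<Rightarrow> 'a mat \<Rightarrow> 'a state \<Rightarrow> 'a state" where
  "write_matrix x k A \<sigma> = \<sigma>\<lparr>fmem := (fmem \<sigma>)(x := (\<lambda>is.
     if \<exists>r<k. \<exists>c<k. is = [r, c] then A $$ (is ! 0, is ! 1) else fmem \<sigma> x is))\<rparr>"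

text \<open>
  \<open>exec bb K cost c \<sigma> t \<sigma>'\<close>: started in \<open>\<sigma>\<close>, the program \<open>c\<close> terminates in \<open>\<sigma>'\<close> after time \<open>t\<close>.
  The black box \<open>bb\<close> accepts matrices of dimension at most \<open>K\<close> (with a larger dimension there is
  no run), and a query with \<open>k \<times> k\<close> matrices takes time \<open>cost k\<close>.
\<close>

inductive exec ::
  "'a::field blackbox \<Rightarrow> nat \<Rightarrow> (nat \<Rightarrow> nat) \<Rightarrow> com \<Rightarrow> 'a state \<Rightarrow> nat \<Rightarrow> 'a state \<Rightarrow> bool"
  for bb K cost where
  Skip: "exec bb K cost Skip \<sigma> 1 \<sigma>"
| NAssign: "exec bb K cost (NAssign x es e) \<sigma> 1 (nupdate x (map (nval \<sigma>) es) (nval \<sigma> e) \<sigma>)"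
| FAssign: "exec bb K cost (FAssign x es e) \<sigma> 1 (fupdate x (map (nval \<sigma>) es) (fval \<sigma> e) \<sigma>)"
| Seq: "exec bb K cost c1 \<sigma> t1 \<sigma>1 \<Longrightarrow> exec bb K cost c2 \<sigma>1 t2 \<sigma>2 \<Longrightarrow>
    exec bb K cost (Seq c1 c2) \<sigma> (t1 + t2) \<sigma>2"
| CondTrue: "bval \<sigma> b \<Longrightarrow> exec bb K cost c1 \<sigma> t \<sigma>' \<Longrightarrow> exec bb K cost (Cond b c1 c2) \<sigma> (1 + t) \<sigma>'"
| CondFalse: "\<not> bval \<sigma> b \<Longrightarrow> exec bb K cost c2 \<sigma> t \<sigma>' \<Longrightarrow> exec bb K cost (Cond b c1 c2) \<sigma> (1 + t) \<sigma>'"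
| WhileFalse: "\<not> bval \<sigma> b \<Longrightarrow> exec bb K cost (While b c) \<sigma> 1 \<sigma>"
| WhileTrue: "bval \<sigma> b \<Longrightarrow> exec bb K cost c \<sigma> t1 \<sigma>1 \<Longrightarrow> exec bb K cost (While b c) \<sigma>1 t2 \<sigma>2 \<Longrightarrow>
    exec bb K cost (While b c) \<sigma> (1 + t1 + t2) \<sigma>2"
| Query: "nval \<sigma> k = m \<Longrightarrow> m \<le> K \<Longrightarrow>
    exec bb K cost (Query y i j k x) \<sigma> (1 + cost m)
      (write_matrix y m (bb (nval \<sigma> i) (nval \<sigma> j) m (read_matrices \<sigma> x m)) \<sigma>)"

lemma exec_deterministic:
  "exec bb K cost c \<sigma> t \<sigma>' \<Longrightarrow> exec bb K cost c \<sigma> t' \<sigma>'' \<Longrightarrow> t' = t \<and> \<sigma>'' = \<sigma>'"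
proof (induction arbitrary: t' \<sigma>'' rule: exec.induct)
  case (WhileTrue \<sigma> b c t1 \<sigma>1 t2 \<sigma>2)
  from WhileTrue.prems WhileTrue.hyps show ?case
    by (cases rule: exec.cases) (use WhileTrue.IH in blast)+
qed (erule exec.cases; blast)+


section \<open>Input and output\<close>

text \<open>The input consists of three numbers; the rest of the memory is zero.\<close>

definition initial_state :: "nat \<Rightarrow> nat \<Rightarrow> nat \<Rightarrow> 'a::field state" where
  "initial_state n d s =
     \<lparr>nmem = (\<lambda>x is. if is = [] then
                       if x = ''n'' then n else if x = ''d'' then d else if x = ''s'' then s else 0
                     else 0),
      fmem = (\<lambda>x is. 0)\<rparr>"

text \<open>
  The ABP in \<open>n\<close> variables written in a memory. Only arcs with a nonzero flag are present; as every
  gate of an ABP except the source has an incoming arc, a program that starts with zero memory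
  spends at least one step for each of them.
\<close>

definition output_abp :: "nat \<Rightarrow> 'a::field state \<Rightarrow> 'a abp" where
  "output_abp n \<sigma> =
     \<lparr>abp_nvars = n,
      abp_depth = nmem \<sigma> ''depth'' [],
      abp_graph =
        \<lparr>pverts = {(i, j). i \<le> nmem \<sigma> ''depth'' [] \<and> j < nmem \<sigma> ''width'' [i]},
         parcs = {((i, u), (i', v)). i' = Suc i \<and> i' \<le> nmem \<sigma> ''depth'' [] \<and>
                    u < nmem \<sigma> ''width'' [i] \<and> v < nmem \<sigma> ''width'' [i'] \<and>
                    nmem \<sigma> ''arc'' [i, u, v] \<noteq> 0}\<rparr>,
      abp_coeff = (\<lambda>((i, u), (_, v)) t. fmem \<sigma> ''coeff'' [i, u, v, t])\<rparr>"

end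

theory Submission
  imports Defs
begin

text \<open>
  Let \<open>c\<^sub>i(w)\<close> be the vector of the coefficients of a word \<open>w\<close> of length \<open>i\<close> in the gates of level \<open>i\<close>. Then
  \<open>c\<^sub>i\<^sub>+\<^sub>1(w x\<^sub>t)\<close> is a linear image of \<open>c\<^sub>i(w)\<close>. Suppose that linear functionals \<open>\<phi>\<^sub>u\<close> on the polynomials of degree
  \<open>i\<close> are given such that each \<open>c\<^sub>i(w)\<close> is the sum of the vectors \<open>\<phi>\<^sub>u(gates)\<close> weighted by its own entries. Then
  the numbers \<open>a\<^sub>u\<^sub>v\<^sub>t = (\<phi>\<^sub>u \<otimes> x\<^sub>t\<^sup>*)(gate v of level i + 1)\<close> are valid arc coefficients: they satisfy
  \<open>c\<^sub>i\<^sub>+\<^sub>1(w x\<^sub>t)\<^sub>v = (\<Sum>u. c\<^sub>i(w)\<^sub>u a\<^sub>u\<^sub>v\<^sub>t)\<close>, and the polynomials of all gates are reproduced.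

  If the matrix \<open>A\<close> with rows \<open>(u, t)\<close>, columns \<open>v\<close> and entries \<open>a\<^sub>u\<^sub>v\<^sub>t\<close> has a generalized inverse \<open>G\<close>, that is
  \<open>A G A = A\<close>, then combining the functionals \<open>\<phi>\<^sub>u \<otimes> x\<^sub>t\<^sup>*\<close> by \<open>G\<close> gives functionals of the same kind for
  level \<open>i + 1\<close>; \<open>G\<close> is found by Gaussian elimination. A functional built up in this way is an entry of the value of a
  polynomial at strictly upper triangular matrices of dimension at most \<open>d s + 1\<close>, so that the numbers
  \<open>a\<^sub>u\<^sub>v\<^sub>t\<close> come from single queries, over any field. Positions that are not gates need no special
  treatment because their polynomial is zero.
\<close>

section \<open>Coefficients of gate polynomials\<close>

text \<open>A word ends in the letter \<open>t\<close> in at most one way, so only the word without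
  its last letter contributes. The induction adds the monomials of \<open>f\<close> one at a
  time.\<close>

lemma lookup_mult_single_snoc:
  fixes f :: "'a::field ncpoly"
  shows "Poly_Mapping.lookup (f * Poly_Mapping.single (Word [t]) a) (Word w) =
    (if w \<noteq> [] \<and> last w = t then Poly_Mapping.lookup f (Word (butlast w)) * a else 0)"
proof (induction f rule: update_induct)
  case const
  then show ?case by simp
next
  case (update f k b)
  have split: "Poly_Mapping.update k b f = f + Poly_Mapping.single k b"
    using update.hyps by (intro poly_mapping_eqI) (auto simp: lookup_update lookup_add lookup_single in_keys_iff)
  have "Poly_Mapping.lookup (Poly_Mapping.single k b * Poly_Mapping.single (Word [t]) a) (Word w) =
      (if w \<noteq> [] \<and> last w = t then Poly_Mapping.lookup (Poly_Mapping.single k b) (Word (butlast w)) * a else 0)"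
    by (cases k, cases w rule: rev_cases) (auto simp: mult_single lookup_single when_def plus_ncmonom_def)
  with update.IH show ?case
    by (auto simp: split lookup_add algebra_simps)
qed

lemma lookup_mult_abp_label:
  fixes f :: "'a::field ncpoly"
  shows "Poly_Mapping.lookup (f * abp_label P e) (Word w) =
    (if w \<noteq> [] \<and> last w < abp_nvars P
     then Poly_Mapping.lookup f (Word (butlast w)) * abp_coeff P e (last w) else 0)"
proof -
  have "ncconst a * ncvar t = Poly_Mapping.single (Word [t]) a" for a :: 'a and t
    by (simp add: ncconst_def ncvar_def mult_single)
  then have "Poly_Mapping.lookup (f * abp_label P e) (Word w) = (\<Sum>t<abp_nvars P.
      if w \<noteq> [] \<and> last w = t then Poly_Mapping.lookup f (Word (butlast w)) * abp_coeff P e t else 0)"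
    by (simp add: abp_label_def sum_distrib_left lookup_sum lookup_mult_single_snoc)
  also have "\<dots> = (if w \<noteq> [] \<and> last w < abp_nvars P
     then Poly_Mapping.lookup f (Word (butlast w)) * abp_coeff P e (last w) else 0)"
    by (cases "w = []") (simp_all add: sum.delta')
  finally show ?thesis .
qed

definition gate_coeff :: "'a::field abp \<Rightarrow> nat \<Rightarrow> nat \<Rightarrow> nat list \<Rightarrow> 'a" where
  "gate_coeff P i v w = Poly_Mapping.lookup (gate_poly P (i, v)) (Word w)"

section \<open>Paths in graphs whose arcs raise a level\<close>

lemma (in pair_wf_digraph) level_le_if_awalk:
  fixes level :: "'a \<Rightarrow> nat"
  assumes level: "\<And>u v. (u, v) \<in> parcs G \<Longrightarrow> level u < level v"
    and "awalk u p v" and "x \<in> set (pawalk_verts u p)"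
  shows "level x \<le> level v"
  using assms(2,3)
proof (induction p arbitrary: u x)
  case Nil
  then show ?case by (simp add: awalk_simps)
next
  case (Cons e p)
  obtain a b where e: "e = (a, b)" by fastforce
  have *: "a = u" "(a, b) \<in> parcs G" "awalk b p v"
    using Cons.prems(1) e by (auto simp: awalk_simps)
  have "b \<in> set (pawalk_verts b p)"
    by (cases p) (use * in \<open>auto simp: awalk_simps\<close>)
  then have "level b \<le> level v" using Cons.IH * by blast
  moreover have "level a < level b" using level * by blast
  moreover have "x = a \<or> x \<in> set (pawalk_verts b p)" using Cons.prems(2) e by auto
  ultimately show ?case using Cons.IH[OF *(3), of x] by auto
qed

text \<open>The head of a further arc lies strictly above every vertex visited so far. Appending an
  arc therefore never revisits a vertex, and a path can be split at its last arc.\<close>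

lemma (in pair_wf_digraph) apath_snoc_iff:
  fixes level :: "'a \<Rightarrow> nat"
  assumes level: "\<And>u v. (u, v) \<in> parcs G \<Longrightarrow> level u < level v"
  shows "apath s (p @ [e]) v \<longleftrightarrow> apath s p (fst e) \<and> e \<in> parcs G \<and> snd e = v"
proof -
  have verts: "pawalk_verts s (p @ [e]) = pawalk_verts s p @ [snd e]" if "awalk s p (fst e)"
    using that by (induction p arbitrary: s) (auto simp: awalk_simps)
  have walk: "awalk s (p @ [e]) v \<longleftrightarrow> awalk s p (fst e) \<and> e \<in> parcs G \<and> snd e = v"
    using in_arcsD1 in_arcsD2 by (induction p arbitrary: s) (cases e, auto simp: awalk_simps)
  have new: "snd e \<notin> set (pawalk_verts s p)" if "awalk s p (fst e)" "e \<in> parcs G"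
    using level_le_if_awalk[where level = level, OF level that(1), of "snd e"] level[of "fst e" "snd e"] that(2)
    by auto
  show ?thesis
    unfolding apath_def walk using verts new by auto
qed

locale abp =
  fixes P :: "'a::field abp"
  assumes is_abp: "is_abp P"
begin

lemma fin_digraph: "pair_fin_digraph (abp_graph P)"
  and level_arc: "\<And>u v. (u, v) \<in> parcs (abp_graph P) \<Longrightarrow> fst v = Suc (fst u)"
  and source_level: "{v \<in> pverts (abp_graph P). fst v = 0} = {(0, 0)}"
  using is_abp by (auto simp: is_abp_def Let_def)

sublocale graph: pair_fin_digraph "abp_graph P"
  by (rule fin_digraph)

lemma apath_snoc_iff:
  "graph.apath s (p @ [e]) v \<longleftrightarrow> graph.apath s p (fst e) \<and> e \<in> parcs (abp_graph P) \<and> snd e = v"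
  by (rule graph.apath_snoc_iff[where level = fst]) (simp add: level_arc)

lemma apath_level_0_iff: "graph.apath (0, 0) p (0, v) \<longleftrightarrow> p = [] \<and> v = 0"
proof (cases p rule: rev_cases)
  case Nil
  then show ?thesis
    using source_level by (auto simp: graph.apath_Nil_iff)
next
  case (snoc q e)
  then show ?thesis
    using level_arc[of "fst e" "snd e"] by (auto simp: apath_snoc_iff)
qed

lemma gate_poly_level_0: "gate_poly P (0, v) = (if v = 0 then 1 else 0)"
  by (simp add: gate_poly_def apath_level_0_iff)

lemma gate_poly_Suc:
  "gate_poly P (Suc i, v) = (\<Sum>u | ((i, u), (Suc i, v)) \<in> parcs (abp_graph P).
     gate_poly P (i, u) * abp_label P ((i, u), (Suc i, v)))"
proof -
  let ?U = "{u. ((i, u), (Suc i, v)) \<in> parcs (abp_graph P)}"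
  let ?p = "\<lambda>u. {p. graph.apath (0, 0) p (i, u)}"
  have fin: "finite (?p u)" for u
    by (rule graph.apaths_finite)
  have "finite ((\<lambda>u. ((i, u), (Suc i, v))) ` ?U)"
    by (rule finite_subset[OF _ graph.pair_finite_arcs]) auto
  then have finU: "finite ?U"
    by (rule finite_imageD) (auto simp: inj_on_def)
  \<comment> \<open>A path to level \<open>Suc i\<close> is nonempty; its last arc starts on level
    \<open>i\<close> because arcs raise the level by exactly one.\<close>
  have paths: "{p. graph.apath (0, 0) p (Suc i, v)} =
      (\<lambda>(u, p). p @ [((i, u), (Suc i, v))]) ` (SIGMA u:?U. ?p u)" (is "?L = ?R")
  proof (intro equalityI subsetI)
    fix p assume p: "p \<in> ?L"
    show "p \<in> ?R"
    proof (cases p rule: rev_cases)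
      case Nil
      with p show ?thesis by (simp add: graph.apath_Nil_iff)
    next
      case (snoc q e)
      obtain j u w where e: "e = ((j, u), w)" by (metis prod.exhaust)
      then show ?thesis
        using p snoc level_arc[of "(j, u)" w] by (force simp: apath_snoc_iff image_iff)
    qed
  qed (auto simp: apath_snoc_iff)
  have "inj_on (\<lambda>(u, p). p @ [((i, u), (Suc i, v))]) (SIGMA u:?U. ?p u)"
    by (auto simp: inj_on_def)
  then have "gate_poly P (Suc i, v) = (\<Sum>(u, p)\<in>(SIGMA u:?U. ?p u).
      prod_list (map (abp_label P) p) * abp_label P ((i, u), (Suc i, v)))"
    unfolding gate_poly_def paths
    by (simp add: sum.reindex case_prod_unfold)
  also have "\<dots> = (\<Sum>u\<in>?U. \<Sum>p\<in>?p u.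
      prod_list (map (abp_label P) p) * abp_label P ((i, u), (Suc i, v)))"
    using finU fin by (subst sum.Sigma) auto
  finally show ?thesis
    by (simp add: gate_poly_def sum_distrib_right)
qed

lemma gate_coeff_0: "gate_coeff P 0 v w = (if v = 0 \<and> w = [] then 1 else 0)"
  by (simp add: gate_coeff_def gate_poly_level_0 lookup_one zero_ncmonom_def when_def)

lemma gate_coeff_Suc:
  "gate_coeff P (Suc i) v w =
    (if w \<noteq> [] \<and> last w < abp_nvars P then
       \<Sum>u | ((i, u), (Suc i, v)) \<in> parcs (abp_graph P).
         gate_coeff P i u (butlast w) * abp_coeff P ((i, u), (Suc i, v)) (last w) else 0)"
  by (simp add: gate_coeff_def gate_poly_Suc lookup_sum lookup_mult_abp_label)

text \<open>Every arc contributes exactly one letter, so the polynomial of a gate on level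
  \<open>i\<close> is homogeneous of degree \<open>i\<close>.\<close>

lemma gate_coeff_eq_0:
  assumes "\<not> (length w = i \<and> set w \<subseteq> {..<abp_nvars P})"
  shows "gate_coeff P i v w = 0"
  using assms
proof (induction i arbitrary: v w)
  case 0
  then show ?case by (auto simp: gate_coeff_0)
next
  case (Suc i)
  show ?case
  proof (cases "w \<noteq> [] \<and> last w < abp_nvars P")
    case True
    then have "\<not> (length (butlast w) = i \<and> set (butlast w) \<subseteq> {..<abp_nvars P})"
      using Suc.prems by (cases w rule: rev_cases) auto
    then show ?thesis by (simp add: gate_coeff_Suc Suc.IH)
  next
    case False
    then show ?thesis unfolding gate_coeff_Suc by (rule if_not_P)
  qed
qed

text \<open>Giving absent arcs the label 0 lets the sum run over all positions below the size, so
  that the widths of \<open>P\<close> disappear from the recursion.\<close>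

lemma gate_coeff_snoc:
  assumes "t < abp_nvars P"
  shows "gate_coeff P (Suc i) v (w @ [t]) = (\<Sum>u<abp_size P. gate_coeff P i u w *
    (if ((i, u), (Suc i, v)) \<in> parcs (abp_graph P) then abp_coeff P ((i, u), (Suc i, v)) t else 0))"
proof -
  obtain width where width: "pverts (abp_graph P) = {(i, j). i \<le> abp_depth P \<and> j < width i}"
    using is_abp by (auto simp: is_abp_def Let_def)
  \<comment> \<open>Positions are numbered from 0 without gaps, so each lies below the width of its
    level, which is at most the number of all gates.\<close>
  have "{u. ((i, u), (Suc i, v)) \<in> parcs (abp_graph P)} \<subseteq> {..<abp_size P}"
  proof
    fix u assume "u \<in> {u. ((i, u), (Suc i, v)) \<in> parcs (abp_graph P)}"
    then have "(i, u) \<in> pverts (abp_graph P)"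
      using graph.in_arcsD1 by blast
    then have u: "i \<le> abp_depth P" "u < width i" by (auto simp: width)
    have "card (Pair i ` {..<width i}) \<le> abp_size P"
      unfolding abp_size_def using u
      by (intro card_mono graph.pair_finite_verts) (auto simp: width)
    then show "u \<in> {..<abp_size P}" using u by (simp add: card_image inj_on_def)
  qed
  then show ?thesis
    by (simp add: gate_coeff_Suc assms) (rule sum.mono_neutral_cong_left, auto)
qed

end

section \<open>Linear functionals given by matrix evaluations\<close>

text \<open>\<open>phi X w c\<close> is entry \<open>(0, c)\<close> of the product of the strictly upper triangular matrices of the letters of
  \<open>rev w\<close>, independently of their dimension.\<close>

fun phi :: "(nat \<Rightarrow> nat \<Rightarrow> nat \<Rightarrow> 'a::field) \<Rightarrow> nat list \<Rightarrow> nat \<Rightarrow> 'a" where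
  "phi X [] c = (if c = 0 then 1 else 0)"
| "phi X (t # w) c = (\<Sum>r<c. phi X w r * X t r c)"

text \<open>The recursion for column \<open>c\<close> visits only smaller columns. Hence filling
  later columns leaves the functionals already built intact.\<close>

lemma phi_cong:
  assumes "\<And>t r c'. c' \<le> c \<Longrightarrow> r < c' \<Longrightarrow> X t r c' = Y t r c'"
  shows "phi X w c = phi Y w c"
  using assms by (induction w arbitrary: c) (auto intro!: sum.cong)

lemma eval_word_carrier:
  assumes "\<And>t. X t \<in> carrier_mat k k"
  shows "foldr (\<lambda>t A. X t * A) w (1\<^sub>m k) \<in> carrier_mat k k"
  by (induction w) (use assms in \<open>auto intro: mult_carrier_mat\<close>)

lemma foldr_mult_mat:
  fixes X :: "nat \<Rightarrow> 'a::field mat"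
  assumes X: "\<And>t. X t \<in> carrier_mat k k" and A: "A \<in> carrier_mat k k"
  shows "foldr (\<lambda>t A. X t * A) w A = foldr (\<lambda>t A. X t * A) w (1\<^sub>m k) * A"
proof (induction w)
  case (Cons t w)
  have "foldr (\<lambda>t A. X t * A) w (1\<^sub>m k) \<in> carrier_mat k k"
    using X by (rule eval_word_carrier)
  then show ?case using Cons.IH assoc_mult_mat[OF X _ A] by simp
qed (use A in simp)

text \<open>The matrix of the last letter acts on row 0 from the right, and triangularity restricts
  the sum to \<open>r < c\<close>. This is why \<open>phi\<close> consumes the reversed
  word.\<close>

lemma eval_word_row_0:
  fixes X :: "nat \<Rightarrow> nat \<Rightarrow> nat \<Rightarrow> 'a::field"
  assumes upper: "\<And>t r c. c \<le> r \<Longrightarrow> c < k \<Longrightarrow> X t r c = 0" and "c < k"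
  shows "eval_word k (\<lambda>t. mat k k (\<lambda>(r, c). X t r c)) (Word w) $$ (0, c) = phi X (rev w) c"
  using \<open>c < k\<close>
proof (induction w arbitrary: c rule: rev_induct)
  case Nil
  then show ?case by (simp add: eval_word_def)
next
  case (snoc t w)
  let ?M = "\<lambda>t. mat k k (\<lambda>(r, c). X t r c)"
  let ?E = "foldr (\<lambda>t A. ?M t * A) w (1\<^sub>m k)"
  have M: "?M t \<in> carrier_mat k k" for t by simp
  have E: "?E \<in> carrier_mat k k" by (rule eval_word_carrier) simp
  have "eval_word k ?M (Word (w @ [t])) = ?E * ?M t"
    using foldr_mult_mat[where X = ?M and w = w, OF M M[of t]] by (simp add: eval_word_def)
  also have "\<dots> $$ (0, c) = (\<Sum>r<k. ?E $$ (0, r) * X t r c)"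
    using E snoc.prems by (simp add: times_mat_def scalar_prod_def lessThan_atLeast0)
  also have "\<dots> = (\<Sum>r<k. phi X (rev w) r * X t r c)"
    using snoc.IH by (intro sum.cong) (simp_all add: eval_word_def)
  also have "\<dots> = (\<Sum>r<c. phi X (rev w) r * X t r c)"
    using snoc.prems upper by (intro sum.mono_neutral_right) auto
  finally show ?case by simp
qed

section \<open>Words of fixed length and the evaluation of homogeneous polynomials\<close>

definition words :: "nat \<Rightarrow> nat \<Rightarrow> nat list set" where
  "words n i = {w. set w \<subseteq> {..<n} \<and> length w = i}"

lemma finite_words: "finite (words n i)"
  by (simp add: words_def finite_lists_length_eq)

lemma words_0: "words n 0 = {[]}"
  by (auto simp: words_def)

lemma sum_words_Suc: "(\<Sum>w\<in>words n (Suc i). f w) = (\<Sum>w\<in>words n i. \<Sum>t<n. f (w @ [t]))"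
proof -
  have "words n (Suc i) = (\<lambda>(w, t). w @ [t]) ` (words n i \<times> {..<n})"
  proof (intro equalityI subsetI)
    fix w assume "w \<in> words n (Suc i)"
    then show "w \<in> (\<lambda>(w, t). w @ [t]) ` (words n i \<times> {..<n})"
      by (cases w rule: rev_cases) (force simp: words_def)+
  qed (auto simp: words_def)
  moreover have "inj_on (\<lambda>(w, t). w @ [t]) (words n i \<times> {..<n})"
    by (auto simp: inj_on_def)
  ultimately show ?thesis
    by (simp add: sum.reindex sum.cartesian_product case_prod_unfold)
qed

lemma (in abp) eval_gate_row_0:
  fixes X :: "nat \<Rightarrow> nat \<Rightarrow> nat \<Rightarrow> 'a"
  assumes upper: "\<And>t r c. c \<le> r \<Longrightarrow> c < k \<Longrightarrow> X t r c = 0" and "c < k"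
  shows "blackbox_of P i v k (\<lambda>t. mat k k (\<lambda>(r, c). X t r c)) $$ (0, c) =
    (\<Sum>w\<in>words (abp_nvars P) i. gate_coeff P i v w * phi X (rev w) c)"
proof -
  let ?f = "gate_poly P (i, v)"
  let ?M = "\<lambda>t. mat k k (\<lambda>(r, c). X t r c)"
  \<comment> \<open>By homogeneity, so the sum over the support may be extended to all words of
    length \<open>i\<close>.\<close>
  have sub: "Poly_Mapping.keys ?f \<subseteq> Word ` words (abp_nvars P) i"
  proof
    fix m assume m: "m \<in> Poly_Mapping.keys ?f"
    obtain w where w: "m = Word w" by (cases m)
    have "w \<in> words (abp_nvars P) i"
      using gate_coeff_eq_0[of w i v] m by (auto simp: w gate_coeff_def words_def in_keys_iff)
    then show "m \<in> Word ` words (abp_nvars P) i" by (simp add: w)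
  qed
  have "blackbox_of P i v k ?M $$ (0, c) =
      (\<Sum>m\<in>Poly_Mapping.keys ?f. Poly_Mapping.lookup ?f m * eval_word k ?M m $$ (0, c))"
    using \<open>c < k\<close> by (simp add: blackbox_of_def eval_ncpoly_def)
  also have "\<dots> = (\<Sum>m\<in>Word ` words (abp_nvars P) i. Poly_Mapping.lookup ?f m * eval_word k ?M m $$ (0, c))"
    using sub by (intro sum.mono_neutral_left finite_imageI finite_words) (auto simp: in_keys_iff)
  also have "\<dots> = (\<Sum>w\<in>words (abp_nvars P) i. gate_coeff P i v w * eval_word k ?M (Word w) $$ (0, c))"
    by (subst sum.reindex) (auto simp: inj_on_def gate_coeff_def)
  finally show ?thesis
    using upper \<open>c < k\<close> by (simp add: eval_word_row_0)
qed

section \<open>Generalized inverses by pivoting\<close>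

text \<open>In matrix form, \<open>L = I + A G\<close> and \<open>L A = 0\<close> give
  \<open>A = A (- G) A\<close>.\<close>

lemma generalized_inverse_if_reduced:
  fixes A :: "'i \<Rightarrow> 'j \<Rightarrow> 'a::field"
  assumes fin: "finite R" "finite C" and "p \<in> R" "v \<in> C"
    and L: "\<And>p p'. p \<in> R \<Longrightarrow> p' \<in> R \<Longrightarrow> L p p' = (if p = p' then 1 else 0) + (\<Sum>v\<in>C. A p v * G v p')"
    and R: "(\<Sum>p'\<in>R. L p p' * A p' v) = 0"
  shows "A p v = (\<Sum>u\<in>C. A p u * (\<Sum>p'\<in>R. - G u p' * A p' v))"
proof -
  have "0 = (\<Sum>p'\<in>R. ((if p = p' then 1 else 0) + (\<Sum>u\<in>C. A p u * G u p')) * A p' v)"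
    using R L \<open>p \<in> R\<close> by simp
  also have "\<dots> = A p v + (\<Sum>p'\<in>R. (\<Sum>u\<in>C. A p u * G u p') * A p' v)"
    using fin \<open>p \<in> R\<close> by (simp add: distrib_right sum.distrib if_distrib[of "\<lambda>z. z * _"] cong: if_cong)
  also have "(\<Sum>p'\<in>R. (\<Sum>u\<in>C. A p u * G u p') * A p' v) = (\<Sum>u\<in>C. A p u * (\<Sum>p'\<in>R. G u p' * A p' v))"
    unfolding sum_distrib_left sum_distrib_right by (subst sum.swap) (simp add: mult.assoc)
  finally show ?thesis
    by (simp add: sum_negf eq_neg_iff_add_eq_0)
qed

text \<open>If \<open>M p q = 0\<close>, then \<open>M\<close> is unchanged because \<open>x / 0 = 0\<close>; so the program need not test for this.\<close>

definition pivot :: "'i \<Rightarrow> 'i \<Rightarrow> ('i \<Rightarrow> 'i \<Rightarrow> 'a::field) \<Rightarrow> 'i \<Rightarrow> 'i \<Rightarrow> 'a" where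
  "pivot p q M x y = M x y - M x q / M p q * M p y"

lemma pivot_row_eq_0:
  assumes "M p q \<noteq> 0" shows "pivot p q M p y = 0"
  using assms by (simp add: pivot_def)

lemma pivot_eq_if_pivot_0:
  assumes "M p q = 0" shows "pivot p q M = M"
  using assms by (simp add: pivot_def fun_eq_iff)

text \<open>Pivoting on entries in \<open>R \<times> C\<close> turns the block matrix \<open>(A, I; I, 0)\<close> with row blocks \<open>R, C\<close> and column
  blocks \<open>C, R\<close> into a matrix of the form \<open>(A - A G A, I - A G; I - G A, - G)\<close>. Both identities below
  are linear in \<open>M\<close> and say that the blocks fit together in this way.\<close>

definition reduction :: "'i set \<Rightarrow> 'i set \<Rightarrow> ('i \<Rightarrow> 'i \<Rightarrow> 'a::field) \<Rightarrow> ('i \<Rightarrow> 'i \<Rightarrow> 'a) \<Rightarrow> bool" where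
  "reduction R C A M \<longleftrightarrow>
    (\<forall>x\<in>R \<union> C. \<forall>v\<in>C. M x v - (\<Sum>p\<in>R. M x p * A p v) = (if x = v then 1 else 0)) \<and>
    (\<forall>p\<in>R. \<forall>y\<in>R \<union> C. M p y - (\<Sum>v\<in>C. A p v * M v y) = (if p = y then 1 else 0))"

lemma reduction_init:
  fixes A :: "'i \<Rightarrow> 'i \<Rightarrow> 'a::field"
  assumes "finite R" "finite C" "R \<inter> C = {}"
    and M: "\<And>x y. x \<in> R \<union> C \<Longrightarrow> y \<in> R \<union> C \<Longrightarrow>
      M x y = (if x \<in> R \<and> y \<in> C then A x y else if x = y then 1 else 0)"
  shows "reduction R C A M"
proof -
  have "(\<Sum>p\<in>R. M x p * A p v) = (if x \<in> R then A x v else 0)" if "x \<in> R \<union> C" "v \<in> C" for x v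
  proof -
    have "(\<Sum>p\<in>R. M x p * A p v) = (\<Sum>p\<in>R. if x = p then A p v else 0)"
      using that assms by (intro sum.cong) auto
    then show ?thesis using assms by simp
  qed
  moreover have "(\<Sum>v\<in>C. A p v * M v y) = (if y \<in> C then A p y else 0)" if "p \<in> R" "y \<in> R \<union> C" for p y
  proof -
    have "(\<Sum>v\<in>C. A p v * M v y) = (\<Sum>v\<in>C. if v = y then A p v else 0)"
      using that assms by (intro sum.cong) auto
    then show ?thesis using assms by simp
  qed
  ultimately show ?thesis
    using assms(3) by (auto simp: reduction_def M)
qed

text \<open>For the first identity, pivoting subtracts a multiple of row \<open>p\<close>, whose
  right-hand side is 0 because \<open>p\<close> is not in \<open>C\<close>. For the second, it
  subtracts a multiple of column \<open>q\<close>, whose right-hand side is 0 because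
  \<open>q\<close> is not in \<open>R\<close>. A zero pivot needs no separate case.\<close>

lemma reduction_pivot:
  assumes "reduction R C A M" "p \<in> R" "q \<in> C" "R \<inter> C = {}"
  shows "reduction R C A (pivot p q M)"
proof -
  have 1: "M x v - (\<Sum>p\<in>R. M x p * A p v) = (if x = v then 1 else 0)" if "x \<in> R \<union> C" "v \<in> C" for x v
    using assms(1) that unfolding reduction_def by blast
  have 2: "M p y - (\<Sum>v\<in>C. A p v * M v y) = (if p = y then 1 else 0)" if "p \<in> R" "y \<in> R \<union> C" for p y
    using assms(1) that unfolding reduction_def by blast
  have "pivot p q M x v - (\<Sum>p'\<in>R. pivot p q M x p' * A p' v) = (if x = v then 1 else 0)"
    if "x \<in> R \<union> C" "v \<in> C" for x v
  proof -
    have "p \<noteq> v" using assms that by blast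
    have "pivot p q M x v - (\<Sum>p'\<in>R. pivot p q M x p' * A p' v) =
       (M x v - (\<Sum>p'\<in>R. M x p' * A p' v)) - M x q / M p q * (M p v - (\<Sum>p'\<in>R. M p p' * A p' v))"
    proof -
      have "(\<Sum>p'\<in>R. pivot p q M x p' * A p' v) =
          (\<Sum>p'\<in>R. M x p' * A p' v) - M x q / M p q * (\<Sum>p'\<in>R. M p p' * A p' v)"
        by (simp only: pivot_def left_diff_distrib sum_subtractf sum_distrib_left mult.assoc)
      then show ?thesis by (simp only: pivot_def) (simp add: algebra_simps)
    qed
    then show ?thesis using 1[OF that] 1[of p v] \<open>p \<noteq> v\<close> assms(2) that by simp
  qed
  moreover have "pivot p q M p' y - (\<Sum>v\<in>C. A p' v * pivot p q M v y) = (if p' = y then 1 else 0)"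
    if "p' \<in> R" "y \<in> R \<union> C" for p' y
  proof -
    have "p' \<noteq> q" using assms that by blast
    have "pivot p q M p' y - (\<Sum>v\<in>C. A p' v * pivot p q M v y) =
       (M p' y - (\<Sum>v\<in>C. A p' v * M v y)) - (M p' q - (\<Sum>v\<in>C. A p' v * M v q)) / M p q * M p y"
    proof -
      have "(\<Sum>v\<in>C. A p' v * pivot p q M v y) =
          (\<Sum>v\<in>C. A p' v * M v y) - (\<Sum>v\<in>C. A p' v * M v q) / M p q * M p y"
        by (simp add: pivot_def right_diff_distrib sum_subtractf sum_distrib_right sum_divide_distrib
            mult.assoc)
      then show ?thesis by (simp only: pivot_def) (simp add: algebra_simps diff_divide_distrib)
    qed
    then show ?thesis using 2[OF that] 2[of p' q] \<open>p' \<noteq> q\<close> assms(3) that by simp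
  qed
  ultimately show ?thesis unfolding reduction_def by blast
qed

text \<open>The second identity on \<open>R \<times> R\<close> expresses that block as
  \<open>I + A G\<close>, where \<open>G\<close> is the block of \<open>M\<close> on
  \<open>C \<times> R\<close>. Once the block on \<open>R \<times> C\<close> is cleared, the first
  identity says that \<open>(I + A G) A\<close> vanishes.\<close>

lemma reduction_generalized_inverse:
  assumes "finite R" "finite C" "R \<inter> C = {}" "reduction R C A M"
    and "\<And>p v. p \<in> R \<Longrightarrow> v \<in> C \<Longrightarrow> M p v = 0" and "p \<in> R" "v \<in> C"
  shows "A p v = (\<Sum>u\<in>C. A p u * (\<Sum>p'\<in>R. - M u p' * A p' v))"
proof (rule generalized_inverse_if_reduced[where L = M and R = R])
  show "M p p' = (if p = p' then 1 else 0) + (\<Sum>v\<in>C. A p v * M v p')" if "p \<in> R" "p' \<in> R" for p p'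
  proof -
    have "M p p' - (\<Sum>v\<in>C. A p v * M v p') = (if p = p' then 1 else 0)"
      using assms(4) that unfolding reduction_def by blast
    then show ?thesis by (simp only: diff_eq_eq)
  qed
  have "M p v - (\<Sum>p'\<in>R. M p p' * A p' v) = (if p = v then 1 else 0)"
    using assms(4,6,7) unfolding reduction_def by blast
  moreover have "p \<noteq> v" "M p v = 0" using assms(3,5-7) by blast+
  ultimately show "(\<Sum>p'\<in>R. M p p' * A p' v) = 0" by simp
qed (use assms in auto)

section \<open>From one level to the next\<close>

text \<open>Evaluation at \<open>X\<close> yields, at entry \<open>(0, i * s + u)\<close> with \<open>s = abp_size P\<close>, the \<open>u\<close>-th of \<open>s\<close> linear
  functionals on the polynomials of degree \<open>i\<close>. Their values on the gates of level \<open>i\<close> form a matrix,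
  and spanning means that it fixes the vector of coefficients of each word \<open>w\<close> in these gates.\<close>

definition functional ::
  "(nat \<Rightarrow> nat \<Rightarrow> nat \<Rightarrow> 'a::field) \<Rightarrow> 'a abp \<Rightarrow> nat \<Rightarrow> nat \<Rightarrow> nat \<Rightarrow> 'a" where
  "functional X P i u v =
     (\<Sum>w\<in>words (abp_nvars P) i. gate_coeff P i v w * phi X (rev w) (i * abp_size P + u))"

definition spanning :: "(nat \<Rightarrow> nat \<Rightarrow> nat \<Rightarrow> 'a::field) \<Rightarrow> 'a abp \<Rightarrow> nat \<Rightarrow> bool" where
  "spanning X P i \<longleftrightarrow> (\<forall>w\<in>words (abp_nvars P) i. \<forall>v<abp_size P.
     gate_coeff P i v w = (\<Sum>u<abp_size P. gate_coeff P i u w * functional X P i u v))"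

text \<open>These are the numbers \<open>a\<^sub>u\<^sub>v\<^sub>t\<close>: the \<open>u\<close>-th
  functional of level \<open>i\<close> is applied to the part of gate \<open>v\<close> of the next
  level whose words end in \<open>x_t\<close>, with that letter removed.\<close>

definition measured :: "(nat \<Rightarrow> nat \<Rightarrow> nat \<Rightarrow> 'a::field) \<Rightarrow> 'a abp \<Rightarrow> nat \<Rightarrow> nat \<Rightarrow> nat \<Rightarrow> nat \<Rightarrow> 'a" where
  "measured X P i u v t = (\<Sum>w\<in>words (abp_nvars P) i.
     gate_coeff P (Suc i) v (w @ [t]) * phi X (rev w) (i * abp_size P + u))"

context abp
begin

text \<open>Row 0 of the empty product is the first unit vector whatever \<open>X\<close> is, so
  functional 0 reads off the constant term, and on level 0 only the source is nonzero.\<close>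

lemma spanning_0:
  assumes "0 < abp_size P"
  shows "spanning X P 0"
proof -
  have "functional X P 0 u v = (if u = 0 \<and> v = 0 then 1 else 0)" for u v
    by (simp add: functional_def words_0 gate_coeff_0)
  then have "(\<Sum>u<abp_size P. gate_coeff P 0 u [] * functional X P 0 u v) =
      (\<Sum>u<abp_size P. if u = 0 then if v = 0 then 1 else 0 else 0)" for v
    by (intro sum.cong) (auto simp: gate_coeff_0)
  then show ?thesis
    using assms by (simp add: spanning_def words_0 gate_coeff_0)
qed

text \<open>Let \<open>F\<close> be the matrix of \<open>functional\<close>, \<open>c\<close> the
  row vector of the coefficients of \<open>w\<close>, and \<open>m\<close> the matrix of the true
  labels for the letter \<open>t\<close>. The measured numbers form \<open>F m\<close>, and spanning
  says \<open>c F = c\<close>, so \<open>c (F m) = c m\<close>.\<close>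

lemma gate_coeff_eq_measured:
  assumes "spanning X P i" "w \<in> words (abp_nvars P) i" "t < abp_nvars P"
  shows "gate_coeff P (Suc i) v (w @ [t]) =
    (\<Sum>u<abp_size P. gate_coeff P i u w * measured X P i u v t)"
proof -
  let ?m = "\<lambda>u. if ((i, u), (Suc i, v)) \<in> parcs (abp_graph P)
    then abp_coeff P ((i, u), (Suc i, v)) t else 0"
  have "measured X P i u v t = (\<Sum>u'<abp_size P. functional X P i u u' * ?m u')" for u
  proof -
    have "measured X P i u v t = (\<Sum>w\<in>words (abp_nvars P) i. \<Sum>u'<abp_size P.
        gate_coeff P i u' w * phi X (rev w) (i * abp_size P + u) * ?m u')"
      unfolding measured_def gate_coeff_snoc[OF assms(3)] sum_distrib_right
      by (intro sum.cong) (simp_all add: ac_simps)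
    then show ?thesis
      unfolding functional_def sum_distrib_right by (subst (asm) sum.swap)
  qed
  then have "(\<Sum>u<abp_size P. gate_coeff P i u w * measured X P i u v t) =
      (\<Sum>u<abp_size P. \<Sum>u'<abp_size P. gate_coeff P i u w * functional X P i u u' * ?m u')"
    by (simp only: sum_distrib_left mult.assoc)
  also have "\<dots> = (\<Sum>u'<abp_size P. (\<Sum>u<abp_size P. gate_coeff P i u w * functional X P i u u') * ?m u')"
    unfolding sum_distrib_right by (rule sum.swap)
  also have "\<dots> = (\<Sum>u'<abp_size P. gate_coeff P i u' w * ?m u')"
    using assms(1,2) by (intro sum.cong) (auto simp: spanning_def)
  also have "\<dots> = gate_coeff P (Suc i) v (w @ [t])"
    by (rule gate_coeff_snoc[OF assms(3), symmetric])
  finally show ?thesis ..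
qed

text \<open>Column \<open>c\<close> is free, and the single entry 1 put there lets it be reached
  only from column \<open>i * abp_size P + u\<close> by the letter \<open>t\<close>. So a word
  contributes only if it ends in \<open>t\<close>, and then with the \<open>u\<close>-th functional
  of the rest.\<close>

lemma blackbox_measured:
  fixes X :: "nat \<Rightarrow> nat \<Rightarrow> nat \<Rightarrow> 'a" and i :: nat
  defines "c \<equiv> i * abp_size P + abp_size P"
  assumes "u < abp_size P" "t < abp_nvars P"
    and upper: "\<And>t r c'. c' \<le> r \<Longrightarrow> X t r c' = 0"
    and new: "\<And>t r. X t r c = 0"
  shows "blackbox_of P (Suc i) v (Suc c) (\<lambda>t'. mat (Suc c) (Suc c)
      (\<lambda>(r, c'). if t' = t \<and> r = i * abp_size P + u \<and> c' = c then 1 else X t' r c')) $$ (0, c) =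
    measured X P i u v t"
proof -
  let ?Y = "\<lambda>t' r c'. if t' = t \<and> r = i * abp_size P + u \<and> c' = c then 1 else X t' r c'"
  have phi_snoc: "phi ?Y (rev (w @ [t'])) c = (if t' = t then phi X (rev w) (i * abp_size P + u) else 0)" for w t'
  proof -
    have "phi ?Y (rev (w @ [t'])) c =
        (\<Sum>r<c. if r = i * abp_size P + u then if t' = t then phi ?Y (rev w) r else 0 else 0)"
      by (simp only: rev_append rev.simps append.simps phi.simps) (intro sum.cong refl, auto simp: new)
    also have "\<dots> = (if t' = t then phi ?Y (rev w) (i * abp_size P + u) else 0)"
      using assms(2) by (simp add: c_def)
    \<comment> \<open>The probe entry sits in a later column and is not seen here.\<close>
    also have "phi ?Y (rev w) (i * abp_size P + u) = phi X (rev w) (i * abp_size P + u)"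
      using assms(2) by (intro phi_cong) (auto simp: c_def)
    finally show ?thesis .
  qed
  have "blackbox_of P (Suc i) v (Suc c) (\<lambda>t'. mat (Suc c) (Suc c) (\<lambda>(r, c'). ?Y t' r c')) $$ (0, c) =
      (\<Sum>w\<in>words (abp_nvars P) (Suc i). gate_coeff P (Suc i) v w * phi ?Y (rev w) c)"
    by (rule eval_gate_row_0) (use assms(2) upper in \<open>auto simp: c_def\<close>)
  also have "\<dots> = (\<Sum>w\<in>words (abp_nvars P) i. \<Sum>t'<abp_nvars P.
      if t' = t then gate_coeff P (Suc i) v (w @ [t]) * phi X (rev w) (i * abp_size P + u) else 0)"
    unfolding sum_words_Suc phi_snoc by (intro sum.cong) auto
  finally show ?thesis
    using assms(3) by (simp add: measured_def)
qed

text \<open>The next \<open>s\<close> columns hold the combinations by \<open>G\<close> of the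
  products of an old functional with a last letter. If \<open>A\<close> is the matrix of measured
  numbers with rows \<open>(u, t)\<close>, the new matrix of functionals is \<open>G A\<close>. A
  word \<open>w x_t\<close> has the coefficient vector \<open>c A_t\<close>, with \<open>A_t\<close>
  the rows of \<open>A\<close> for \<open>t\<close>, and \<open>A_t G A = A_t\<close> shows that
  \<open>G A\<close> fixes it.\<close>

lemma spanning_Suc:
  assumes "spanning X P i"
    and cols: "\<And>t r v. t < abp_nvars P \<Longrightarrow> v < abp_size P \<Longrightarrow> r < i * abp_size P + abp_size P \<Longrightarrow>
      Y t r (i * abp_size P + abp_size P + v) =
        (if i * abp_size P \<le> r then G v (r - i * abp_size P) t else 0)"
    and rows: "\<And>t r v. t < abp_nvars P \<Longrightarrow> v < abp_size P \<Longrightarrow> i * abp_size P + abp_size P \<le> r \<Longrightarrow>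
      Y t r (i * abp_size P + abp_size P + v) = 0"
    and old: "\<And>t r c. c < i * abp_size P + abp_size P \<Longrightarrow> Y t r c = X t r c"
    and G: "\<And>u v t. u < abp_size P \<Longrightarrow> v < abp_size P \<Longrightarrow> t < abp_nvars P \<Longrightarrow>
      measured X P i u v t = (\<Sum>u'<abp_size P. measured X P i u u' t *
        (\<Sum>u2<abp_size P. \<Sum>t2<abp_nvars P. G u' u2 t2 * measured X P i u2 v t2))"
  shows "spanning Y P (Suc i)"
proof -
  let ?s = "abp_size P" and ?n = "abp_nvars P"
  have phi_snoc: "phi Y (rev (w @ [t])) (i * ?s + ?s + v) =
      (\<Sum>u<?s. phi X (rev w) (i * ?s + u) * G v u t)" if "t < ?n" "v < ?s" for w t v
  proof -
    have "phi Y (rev (w @ [t])) (i * ?s + ?s + v) =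
        (\<Sum>r<i * ?s + ?s + v. phi Y (rev w) r * Y t r (i * ?s + ?s + v))" by simp
    \<comment> \<open>A new column is nonzero only in the rows that belong to the functionals of
      level \<open>i\<close>; earlier rows vanish by \<open>cols\<close>, later ones by
      \<open>rows\<close>.\<close>
    also have "\<dots> = (\<Sum>r\<in>{i * ?s..<i * ?s + ?s}. phi Y (rev w) r * Y t r (i * ?s + ?s + v))"
      using that cols rows by (intro sum.mono_neutral_right) (auto simp: not_less)
    also have "\<dots> = (\<Sum>u<?s. phi Y (rev w) (i * ?s + u) * Y t (i * ?s + u) (i * ?s + ?s + v))"
      using sum.shift_bounds_nat_ivl[of "\<lambda>r. phi Y (rev w) r * Y t r (i * ?s + ?s + v)" 0 "i * ?s" ?s]
      by (simp add: add.commute lessThan_atLeast0)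
    also have "\<dots> = (\<Sum>u<?s. phi X (rev w) (i * ?s + u) * G v u t)"
    proof (intro sum.cong refl)
      fix u assume "u \<in> {..<?s}"
      then have "phi Y (rev w) (i * ?s + u) = phi X (rev w) (i * ?s + u)"
        by (intro phi_cong old) auto
      with \<open>u \<in> {..<?s}\<close> that show "phi Y (rev w) (i * ?s + u) * Y t (i * ?s + u) (i * ?s + ?s + v) =
          phi X (rev w) (i * ?s + u) * G v u t"
        by (simp add: cols)
    qed
    finally show ?thesis .
  qed
  \<comment> \<open>This is the identity \<open>F' = G A\<close> for the functionals of the next
    level.\<close>
  have func: "functional Y P (Suc i) u' v = (\<Sum>u2<?s. \<Sum>t2<?n. G u' u2 t2 * measured X P i u2 v t2)"
    if "u' < ?s" for u' v
  proof -
    have "functional Y P (Suc i) u' v = (\<Sum>w\<in>words ?n i. \<Sum>t<?n.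
        gate_coeff P (Suc i) v (w @ [t]) * phi Y (rev (w @ [t])) (i * ?s + ?s + u'))"
      by (simp only: functional_def sum_words_Suc mult_Suc add.commute[of ?s])
    also have "\<dots> = (\<Sum>w\<in>words ?n i. \<Sum>t<?n. \<Sum>u<?s.
        G u' u t * (gate_coeff P (Suc i) v (w @ [t]) * phi X (rev w) (i * ?s + u)))"
    proof (intro sum.cong refl)
      fix w t assume "t \<in> {..<?n}"
      then have "t < ?n" by simp
      show "gate_coeff P (Suc i) v (w @ [t]) * phi Y (rev (w @ [t])) (i * ?s + ?s + u') =
          (\<Sum>u<?s. G u' u t * (gate_coeff P (Suc i) v (w @ [t]) * phi X (rev w) (i * ?s + u)))"
        unfolding phi_snoc[OF \<open>t < ?n\<close> that] sum_distrib_left by (simp only: ac_simps)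
    qed
    also have "\<dots> = (\<Sum>t<?n. \<Sum>w\<in>words ?n i. \<Sum>u<?s.
        G u' u t * (gate_coeff P (Suc i) v (w @ [t]) * phi X (rev w) (i * ?s + u)))"
      by (rule sum.swap)
    also have "\<dots> = (\<Sum>t<?n. \<Sum>u<?s. \<Sum>w\<in>words ?n i.
        G u' u t * (gate_coeff P (Suc i) v (w @ [t]) * phi X (rev w) (i * ?s + u)))"
      by (intro sum.cong refl sum.swap)
    also have "\<dots> = (\<Sum>u<?s. \<Sum>t<?n. G u' u t * measured X P i u v t)"
      unfolding measured_def sum_distrib_left by (rule sum.swap)
    finally show ?thesis .
  qed
  have "gate_coeff P (Suc i) v w = (\<Sum>u<?s. gate_coeff P (Suc i) u w * functional Y P (Suc i) u v)"
    if word: "w \<in> words ?n (Suc i)" and "v < ?s" for v w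
  proof -
    obtain w' t where w: "w = w' @ [t]" "w' \<in> words ?n i" "t < ?n"
      using word by (cases w rule: rev_cases) (auto simp: words_def)
    note eq = gate_coeff_eq_measured[OF assms(1) w(2,3)]
    have "gate_coeff P (Suc i) v w = (\<Sum>u<?s. gate_coeff P i u w' *
        (\<Sum>u'<?s. measured X P i u u' t * functional Y P (Suc i) u' v))"
      unfolding w(1) eq using that(2) w(3) by (intro sum.cong refl) (simp add: G[symmetric] func)
    also have "\<dots> = (\<Sum>u'<?s. (\<Sum>u<?s. gate_coeff P i u w' * measured X P i u u' t) * functional Y P (Suc i) u' v)"
      unfolding sum_distrib_left sum_distrib_right mult.assoc by (rule sum.swap)
    finally show ?thesis unfolding w(1) eq .
  qed
  then show ?thesis by (simp add: spanning_def)
qed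

end

section \<open>Complete layered programs and correctness of the output\<close>

lemma abp_complete_layers:
  fixes w :: "nat \<Rightarrow> nat"
  assumes graph: "pverts (abp_graph Q) = {(i, j). i \<le> abp_depth Q \<and> j < w i}"
    "parcs (abp_graph Q) = {((i, u), (i', v)). i' = Suc i \<and> i' \<le> abp_depth Q \<and> u < w i \<and> v < w i'}"
    and w: "w 0 = 1" "w (abp_depth Q) = 1" "\<And>i. i \<le> abp_depth Q \<Longrightarrow> 0 < w i"
  shows "is_abp Q"
proof -
  let ?G = "abp_graph Q" and ?d = "abp_depth Q"
  have "pverts ?G = (SIGMA i:{..?d}. {..<w i})" by (auto simp: graph)
  then have finV: "finite (pverts ?G)" by simp
  have sub: "parcs ?G \<subseteq> pverts ?G \<times> pverts ?G" by (auto simp: graph)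
  then have finA: "finite (parcs ?G)" using finV by (meson finite_SigmaI finite_subset)
  have wf: "pair_fin_digraph ?G"
    using sub finV finA by unfold_locales auto
  \<comment> \<open>As no level is empty, position 0 of the preceding level always supplies an
    incoming arc; outgoing arcs are treated alike.\<close>
  have "in_degree (with_proj ?G) (i, j) = 0 \<longleftrightarrow> i = 0" if "(i, j) \<in> pverts ?G" for i j
  proof (cases i)
    case (Suc i')
    then have "((i', 0), (i, j)) \<in> parcs ?G" using that w(3)[of i'] by (auto simp: graph)
    then show ?thesis using finA Suc by (auto simp: in_degree_def in_arcs_def)
  next
    case 0
    then have "in_arcs (with_proj ?G) (i, j) = {}" by (auto simp: in_arcs_def graph)
    then show ?thesis using 0 by (simp add: in_degree_def)
  qed
  moreover have "out_degree (with_proj ?G) (i, j) = 0 \<longleftrightarrow> i = ?d" if "(i, j) \<in> pverts ?G" for i j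
  proof (cases "i = ?d")
    case False
    then have "((i, j), (Suc i, 0)) \<in> parcs ?G" using that w(3)[of "Suc i"] by (auto simp: graph)
    then show ?thesis using finA False by (auto simp: out_degree_def out_arcs_def)
  next
    case True
    then have "out_arcs (with_proj ?G) (i, j) = {}" by (auto simp: out_arcs_def graph)
    then show ?thesis using True by (simp add: out_degree_def)
  qed
  ultimately have
    "{v \<in> pverts ?G. in_degree (with_proj ?G) v = 0} = {v \<in> pverts ?G. fst v = 0}"
    "{v \<in> pverts ?G. out_degree (with_proj ?G) v = 0} = {v \<in> pverts ?G. fst v = ?d}"
    by auto
  moreover have "{v \<in> pverts ?G. fst v = 0} = {(0, 0)}" "{v \<in> pverts ?G. fst v = ?d} = {(?d, 0)}"
    using w(1,2) by (auto simp: graph)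
  moreover have "\<forall>(u, v)\<in>parcs ?G. fst v = Suc (fst u)" by (auto simp: graph)
  ultimately show ?thesis
    unfolding is_abp_def Let_def using wf graph(1) by auto
qed

lemma (in abp) size_pos: "0 < abp_size P"
proof -
  have "(0, 0) \<in> pverts (abp_graph P)" using source_level by auto
  then show ?thesis
    unfolding abp_size_def using graph.pair_finite_verts by (auto simp: card_gt_0_iff)
qed

text \<open>By induction on the level, every gate of the output has the coefficients of the same
  position in \<open>P\<close>. Positions that \<open>P\<close> does not occupy simply carry the
  zero polynomial.\<close>

lemma (in abp) output_abp_correct:
  fixes \<sigma> :: "'a state"
  defines "n \<equiv> abp_nvars P" and "d \<equiv> abp_depth P" and "s \<equiv> abp_size P"
  assumes depth: "nmem \<sigma> ''depth'' [] = d"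
    and width: "\<And>i. i \<le> d \<Longrightarrow> nmem \<sigma> ''width'' [i] = (if i = 0 \<or> i = d then 1 else s)"
    and arc: "\<And>i u v. i < d \<Longrightarrow> u < s \<Longrightarrow> v < s \<Longrightarrow> nmem \<sigma> ''arc'' [i, u, v] = 1"
    and coeff: "\<And>i w t v. i < d \<Longrightarrow> w \<in> words n i \<Longrightarrow> t < n \<Longrightarrow> v < s \<Longrightarrow>
      gate_coeff P (Suc i) v (w @ [t]) = (\<Sum>u<s. gate_coeff P i u w * fmem \<sigma> ''coeff'' [i, u, v, t])"
  shows "is_abp (output_abp n \<sigma>)" "abp_poly (output_abp n \<sigma>) = abp_poly P"
proof -
  let ?Q = "output_abp n \<sigma>" and ?w = "\<lambda>i. nmem \<sigma> ''width'' [i]"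
  have s: "0 < s" unfolding s_def by (rule size_pos)
  have w_le: "?w i \<le> s" if "i \<le> d" for i using that width s by auto
  have Q: "abp_nvars ?Q = n" "abp_depth ?Q = d"
    "pverts (abp_graph ?Q) = {(i, j). i \<le> d \<and> j < ?w i}"
    by (auto simp: output_abp_def depth)
  have arcs: "((i, u), (i', v)) \<in> parcs (abp_graph ?Q) \<longleftrightarrow>
      i' = Suc i \<and> i' \<le> d \<and> u < ?w i \<and> v < ?w i'" for i u i' v
  proof -
    have "nmem \<sigma> ''arc'' [i, u, v] \<noteq> 0" if "Suc i \<le> d" "u < ?w i" "v < ?w (Suc i)"
      using that arc[of i u v] w_le[of i] w_le[of "Suc i"] by simp
    then show ?thesis by (auto simp: output_abp_def depth)
  qed
  show abp: "is_abp ?Q"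
  proof (rule abp_complete_layers[where w = ?w])
    show "parcs (abp_graph ?Q) =
        {((i, u), (i', v)). i' = Suc i \<and> i' \<le> abp_depth ?Q \<and> u < ?w i \<and> v < ?w i'}"
      by (auto simp: arcs Q)
  qed (use Q width s in auto)
  then interpret Q: abp ?Q by unfold_locales
  have "gate_coeff ?Q i v w = gate_coeff P i v w" if "i \<le> d" "v < ?w i" "w \<in> words n i" for i v w
    using that
  proof (induction i arbitrary: v w)
    case 0
    then show ?case by (simp add: gate_coeff_0 Q.gate_coeff_0)
  next
    case (Suc i)
    obtain w' t where w: "w = w' @ [t]" "w' \<in> words n i" "t < n"
      using Suc.prems(3) by (cases w rule: rev_cases) (auto simp: words_def)
    have "{u. ((i, u), (Suc i, v)) \<in> parcs (abp_graph ?Q)} = {..<?w i}"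
      using Suc.prems by (auto simp: arcs)
    then have "gate_coeff ?Q (Suc i) v w = (\<Sum>u<?w i. gate_coeff P i u w' * fmem \<sigma> ''coeff'' [i, u, v, t])"
      using Suc w by (simp add: Q.gate_coeff_Suc Q) (simp add: output_abp_def)
    also have "\<dots> = (\<Sum>u<s. gate_coeff P i u w' * fmem \<sigma> ''coeff'' [i, u, v, t])"
    \<comment> \<open>Level 0 of the output has width 1 rather than \<open>s\<close>, but the
      coefficients of \<open>P\<close> at the other positions there are 0.\<close>
    proof (cases "i = 0")
      case True
      then show ?thesis
        using Suc.prems(1) w_le[of i] s width[of 0]
        by (intro sum.mono_neutral_left) (auto simp: gate_coeff_0)
    next
      case False
      then show ?thesis using Suc.prems(1) width[of i] by simp
    qed
    also have "\<dots> = gate_coeff P (Suc i) v w"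
      using Suc.prems w w_le[of "Suc i"] coeff[of i w' t v] by simp
    finally show ?case .
  qed
  then have "gate_coeff ?Q d 0 w = gate_coeff P d 0 w" for w
  proof (cases "w \<in> words n d")
    case False
    then have *: "\<not> (length w = d \<and> set w \<subseteq> {..<n})" by (auto simp: words_def)
    show ?thesis
      using gate_coeff_eq_0[of w d 0, folded n_def, OF *] Q.gate_coeff_eq_0[of w d 0, unfolded Q, OF *]
      by simp
  qed (use width[of d] in auto)
  then show "abp_poly ?Q = abp_poly P"
    unfolding abp_poly_def gate_coeff_def Q d_def
    by (intro poly_mapping_eqI) (metis ncmonom.exhaust)
qed

section \<open>Reasoning about nested loops\<close>

text \<open>Counting loops, outermost first. A bound is evaluated anew before every round, so the
  rules below require that its value does not change.\<close>

fun nest :: "(vname \<times> nexp) list \<Rightarrow> com \<Rightarrow> com" where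
  "nest [] c = c"
| "nest ((x, e) # l) c = Seq (NAssign x [] (NConst 0)) (While (NLess (NVar x []) e)
     (Seq (nest l c) (NAssign x [] (NPlus (NVar x []) (NConst 1)))))"

text \<open>Each round adds a test and an increment; outside there are the initialization and the
  failing test. Any semiring is allowed so that one formula serves for numbers and for
  polynomials.\<close>

fun nest_time :: "'t list \<Rightarrow> 't \<Rightarrow> 't::comm_semiring_1" where
  "nest_time [] T = T"
| "nest_time (m # ms) T = m * (nest_time ms T + 2) + 2"

definition tuples :: "nat list \<Rightarrow> nat list set" where
  "tuples ms = {ks. list_all2 (<) ks ms}"

text \<open>A frame condition on the number memory only; what happens to the field memory is
  recorded in postconditions.\<close>

definition agree :: "vname set \<Rightarrow> 'a state \<Rightarrow> 'a state \<Rightarrow> bool" where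
  "agree V \<sigma> \<tau> \<longleftrightarrow> (\<forall>x. x \<notin> V \<longrightarrow> nmem \<sigma> x = nmem \<tau> x)"

lemma agree_refl: "agree V \<sigma> \<sigma>"
  by (simp add: agree_def)

lemma agree_trans: "agree V \<sigma> \<tau> \<Longrightarrow> agree W \<tau> \<upsilon> \<Longrightarrow> V \<subseteq> U \<Longrightarrow> W \<subseteq> U \<Longrightarrow> agree U \<sigma> \<upsilon>"
  unfolding agree_def by (metis subsetD)

lemma nmem_nupdate: "nmem (nupdate x is m \<sigma>) = (nmem \<sigma>)(x := (nmem \<sigma> x)(is := m))"
  and fmem_nupdate [simp]: "fmem (nupdate x is m \<sigma>) = fmem \<sigma>"
  and nmem_fupdate [simp]: "nmem (fupdate x is a \<sigma>) = nmem \<sigma>"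
  and fmem_fupdate: "fmem (fupdate x is a \<sigma>) = (fmem \<sigma>)(x := (fmem \<sigma> x)(is := a))"
  and nmem_write_matrix [simp]: "nmem (write_matrix x k A \<sigma>) = nmem \<sigma>"
  by (simp_all add: nupdate_def fupdate_def write_matrix_def)

lemma fmem_write_matrix_other: "z \<noteq> x \<Longrightarrow> fmem (write_matrix x k A \<sigma>) z = fmem \<sigma> z"
  by (simp add: write_matrix_def)

lemma fmem_write_matrix: "r < k \<Longrightarrow> c < k \<Longrightarrow> fmem (write_matrix x k A \<sigma>) x [r, c] = A $$ (r, c)"
  by (simp add: write_matrix_def)

text \<open>The postcondition of a nest around one assignment to \<open>A\<close>. Its last clause
  lets several nests write overlapping parts of one array in succession.\<close>

definition filled ::
  "vname \<Rightarrow> nat list \<Rightarrow> (nat list \<Rightarrow> nat list) \<Rightarrow> (nat list \<Rightarrow> 'a) \<Rightarrow> 'a state \<Rightarrow> 'a state \<Rightarrow> bool" where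
  "filled A ms g h \<sigma> \<tau> \<longleftrightarrow> (\<forall>z. z \<noteq> A \<longrightarrow> fmem \<tau> z = fmem \<sigma> z) \<and>
    (\<forall>ks\<in>tuples ms. fmem \<tau> A (g ks) = h ks) \<and>
    (\<forall>is. is \<notin> g ` tuples ms \<longrightarrow> fmem \<tau> A is = fmem \<sigma> A is)"

lemma filledD:
  assumes "filled A ms g h \<sigma> \<tau>"
  shows "z \<noteq> A \<Longrightarrow> fmem \<tau> z = fmem \<sigma> z"
    "ks \<in> tuples ms \<Longrightarrow> is = g ks \<Longrightarrow> fmem \<tau> A is = h ks"
    "(\<And>ks. ks \<in> tuples ms \<Longrightarrow> is \<noteq> g ks) \<Longrightarrow> fmem \<tau> A is = fmem \<sigma> A is"
  using assms unfolding filled_def by (blast, blast, blast)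

locale machine =
  fixes bb :: "'a::field blackbox" and K :: nat and cost :: "nat \<Rightarrow> nat"
begin

text \<open>Total correctness with a time bound and a frame. Existence of a run suffices because
  execution is deterministic.\<close>

definition runs :: "vname set \<Rightarrow> com \<Rightarrow> 'a state \<Rightarrow> nat \<Rightarrow> ('a state \<Rightarrow> bool) \<Rightarrow> bool" where
  "runs V c \<sigma> T Q \<longleftrightarrow> (\<exists>t \<sigma>'. exec bb K cost c \<sigma> t \<sigma>' \<and> t \<le> T \<and> agree V \<sigma>' \<sigma> \<and> Q \<sigma>')"

lemma runs_weaken:
  assumes "runs V c \<sigma> T Q" "V \<subseteq> V'" "T \<le> T'" "\<And>\<sigma>'. agree V \<sigma>' \<sigma> \<Longrightarrow> Q \<sigma>' \<Longrightarrow> Q' \<sigma>'"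
  shows "runs V' c \<sigma> T' Q'"
proof -
  obtain t \<sigma>' where *: "exec bb K cost c \<sigma> t \<sigma>'" "t \<le> T" "agree V \<sigma>' \<sigma>" "Q \<sigma>'"
    using assms(1) by (auto simp: runs_def)
  moreover have "agree V' \<sigma>' \<sigma>" using *(3) assms(2) by (auto simp: agree_def)
  ultimately show ?thesis
    unfolding runs_def using assms(3,4) by (meson le_trans)
qed

lemma runs_FAssign:
  assumes "Q (fupdate x (map (nval \<sigma>) es) (fval \<sigma> e) \<sigma>)"
  shows "runs V (FAssign x es e) \<sigma> 1 Q"
  unfolding runs_def using assms exec.FAssign by (fastforce simp: agree_def)

lemma runs_NAssign:
  assumes "x \<in> V" "Q (nupdate x (map (nval \<sigma>) es) (nval \<sigma> e) \<sigma>)"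
  shows "runs V (NAssign x es e) \<sigma> 1 Q"
  unfolding runs_def using assms exec.NAssign by (fastforce simp: agree_def nmem_nupdate)

lemma runs_Query:
  assumes "nval \<sigma> k = m" "m \<le> K" "cost m \<le> T"
    "Q (write_matrix y m (bb (nval \<sigma> i) (nval \<sigma> j) m (read_matrices \<sigma> x m)) \<sigma>)"
  shows "runs V (Query y i j k x) \<sigma> (1 + T) Q"
proof -
  have "exec bb K cost (Query y i j k x) \<sigma> (1 + cost m)
      (write_matrix y m (bb (nval \<sigma> i) (nval \<sigma> j) m (read_matrices \<sigma> x m)) \<sigma>)"
    by (rule exec.Query[OF assms(1,2)])
  then show ?thesis
    unfolding runs_def using assms(3,4) by (fastforce simp: agree_def)
qed

lemma runs_Seq:
  assumes "runs V c1 \<sigma> T1 Q1" "\<And>\<sigma>'. agree V \<sigma>' \<sigma> \<Longrightarrow> Q1 \<sigma>' \<Longrightarrow> runs V c2 \<sigma>' T2 Q"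
  shows "runs V (Seq c1 c2) \<sigma> (T1 + T2) Q"
proof -
  obtain t1 \<sigma>1 where 1: "exec bb K cost c1 \<sigma> t1 \<sigma>1" "t1 \<le> T1" "agree V \<sigma>1 \<sigma>" "Q1 \<sigma>1"
    using assms(1) by (auto simp: runs_def)
  obtain t2 \<sigma>2 where 2: "exec bb K cost c2 \<sigma>1 t2 \<sigma>2" "t2 \<le> T2" "agree V \<sigma>2 \<sigma>1" "Q \<sigma>2"
    using assms(2)[OF 1(3,4)] by (auto simp: runs_def)
  have "exec bb K cost (Seq c1 c2) \<sigma> (t1 + t2) \<sigma>2"
    by (rule exec.Seq[OF 1(1) 2(1)])
  moreover have "t1 + t2 \<le> T1 + T2" using 1(2) 2(2) by simp
  moreover have "agree V \<sigma>2 \<sigma>"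
    by (rule agree_trans[OF 2(3) 1(3)]) auto
  ultimately show ?thesis
    unfolding runs_def using 2(4) by blast
qed

lemma runs_for:
  assumes bound: "\<And>k \<sigma>'. agree (insert x V) \<sigma>' \<sigma> \<Longrightarrow> I k \<sigma>' \<Longrightarrow> nval \<sigma>' e = m"
    and body: "\<And>k \<sigma>'. k < m \<Longrightarrow> agree (insert x V) \<sigma>' \<sigma> \<Longrightarrow> nmem \<sigma>' x [] = k \<Longrightarrow> I k \<sigma>' \<Longrightarrow>
      runs V (nest l c) \<sigma>' T (\<lambda>\<tau>. I (Suc k) (nupdate x [] (Suc k) \<tau>))"
    and "x \<notin> V" and init: "I 0 (nupdate x [] 0 \<sigma>)"
  shows "runs (insert x V) (nest ((x, e) # l) c) \<sigma> (m * (T + 2) + 2) (I m)"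
proof -
  let ?loop = "While (NLess (NVar x []) e) (Seq (nest l c) (NAssign x [] (NPlus (NVar x []) (NConst 1))))"
  \<comment> \<open>Induction on the number \<open>j\<close> of rounds that remain; the 1 pays for
    the failing test.\<close>
  have loop: "\<exists>t \<tau>. exec bb K cost ?loop \<sigma>' t \<tau> \<and> t \<le> j * (T + 2) + 1 \<and> agree (insert x V) \<tau> \<sigma> \<and> I m \<tau>"
    if "k + j = m" "agree (insert x V) \<sigma>' \<sigma>" "nmem \<sigma>' x [] = k" "I k \<sigma>'" for j k \<sigma>'
    using that
  proof (induction j arbitrary: k \<sigma>')
    case 0
    then have "\<not> bval \<sigma>' (NLess (NVar x []) e)" using bound[of \<sigma>' k] by simp
    then have "exec bb K cost ?loop \<sigma>' 1 \<sigma>'" by (rule exec.WhileFalse)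
    then show ?case using 0 by (intro exI[of _ 1] exI[of _ \<sigma>']) simp
  next
    case (Suc j)
    then have b: "bval \<sigma>' (NLess (NVar x []) e)" using bound[of \<sigma>' k] by simp
    obtain t1 \<tau> where 1: "exec bb K cost (nest l c) \<sigma>' t1 \<tau>" "t1 \<le> T" "agree V \<tau> \<sigma>'"
      "I (Suc k) (nupdate x [] (Suc k) \<tau>)"
      using body[of k \<sigma>'] Suc.prems by (auto simp: runs_def)
    let ?\<tau> = "nupdate x [] (Suc k) \<tau>"
    have "nmem \<tau> x [] = k" using 1(3) \<open>x \<notin> V\<close> Suc.prems by (simp add: agree_def)
    then have inc: "exec bb K cost (NAssign x [] (NPlus (NVar x []) (NConst 1))) \<tau> 1 ?\<tau>"
      using exec.NAssign[of bb K cost x "[]" "NPlus (NVar x []) (NConst 1)" \<tau>] by simp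
    have "agree (insert x V) ?\<tau> \<sigma>"
      using 1(3) Suc.prems by (auto simp: agree_def nmem_nupdate)
    then obtain t2 \<upsilon> where 2: "exec bb K cost ?loop ?\<tau> t2 \<upsilon>" "t2 \<le> j * (T + 2) + 1"
      "agree (insert x V) \<upsilon> \<sigma>" "I m \<upsilon>"
      using Suc.IH[of "Suc k" ?\<tau>] Suc.prems 1(4) by (auto simp: nmem_nupdate)
    have "exec bb K cost ?loop \<sigma>' (1 + (t1 + 1) + t2) \<upsilon>"
      using exec.WhileTrue[OF b exec.Seq[OF 1(1) inc] 2(1)] .
    moreover have "1 + (t1 + 1) + t2 \<le> Suc j * (T + 2) + 1" using 1(2) 2(2) by simp
    ultimately show ?case using 2(3,4) by blast
  qed
  let ?\<sigma> = "nupdate x [] 0 \<sigma>"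
  have "agree (insert x V) ?\<sigma> \<sigma>" by (simp add: agree_def nmem_nupdate)
  then obtain t \<tau> where *: "exec bb K cost ?loop ?\<sigma> t \<tau>" "t \<le> m * (T + 2) + 1"
    "agree (insert x V) \<tau> \<sigma>" "I m \<tau>"
    using loop[of 0 m ?\<sigma>] init by (auto simp: nmem_nupdate)
  have "exec bb K cost (NAssign x [] (NConst 0)) \<sigma> 1 ?\<sigma>"
    using exec.NAssign[of bb K cost x "[]" "NConst 0" \<sigma>] by simp
  then have "exec bb K cost (nest ((x, e) # l) c) \<sigma> (1 + t) \<tau>"
    unfolding nest.simps using *(1) by (rule exec.Seq)
  moreover have "1 + t \<le> m * (T + 2) + 2" using *(2) by simp
  ultimately show ?thesis unfolding runs_def using *(3,4) by blast
qed

text \<open>The invariant is indexed by the set \<open>S\<close> of counter tuples already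
  processed, so that a nest of any depth is handled like a single loop. It must not depend on the
  counters, which is the content of \<open>stable\<close>.\<close>

lemma runs_nest:
  assumes "distinct (map fst l)" "fst ` set l \<inter> V = {}"
    and stable: "\<And>x k S \<tau>. x \<in> fst ` set l \<Longrightarrow> J S \<tau> \<Longrightarrow> J S (nupdate x [] k \<tau>)"
    and bounds: "\<And>\<tau>. agree (fst ` set l \<union> V) \<tau> \<sigma> \<Longrightarrow> map (\<lambda>(x, e). nval \<tau> e) l = ms"
    and body: "\<And>\<tau> ks S. agree (fst ` set l \<union> V) \<tau> \<sigma> \<Longrightarrow> map (\<lambda>(x, e). nmem \<tau> x []) l = ks \<Longrightarrow>
      ks \<in> tuples ms \<Longrightarrow> S \<subseteq> tuples ms - {ks} \<Longrightarrow> J S \<tau> \<Longrightarrow> runs V c \<tau> T (J (insert ks S))"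
    and init: "J {} \<sigma>"
  shows "runs (fst ` set l \<union> V) (nest l c) \<sigma> (nest_time ms T) (J (tuples ms))"
  using assms
proof (induction l arbitrary: \<sigma> ms J)
  case Nil
  have "ms = []" using Nil.prems(4)[OF agree_refl] by simp
  then show ?case
    using Nil.prems(5)[OF agree_refl, of "[]" "{}"] Nil.prems(6) by (simp add: tuples_def)
next
  case (Cons xe l)
  obtain x e where xe: "xe = (x, e)" by fastforce
  obtain m ms' where ms: "ms = m # ms'"
    using Cons.prems(4)[OF agree_refl] by (cases ms) auto
  let ?V = "fst ` set l \<union> V"
  have x: "x \<notin> ?V" using Cons.prems(1,2) by (auto simp: xe)
  have V: "insert x ?V = fst ` set (xe # l) \<union> V" by (simp add: xe)
  \<comment> \<open>The tuples finished before round \<open>k\<close> of the outer loop; the inner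
    nest adds those starting with \<open>k\<close>.\<close>
  let ?B = "\<lambda>k. {j # ks |j ks. j < k \<and> ks \<in> tuples ms'}"
  have "runs (insert x ?V) (nest ((x, e) # l) c) \<sigma> (m * (nest_time ms' T + 2) + 2) (J (?B m))"
  proof (rule runs_for[where I = "\<lambda>k. J (?B k)"])
    show "nval \<sigma>' e = m" if "agree (insert x ?V) \<sigma>' \<sigma>" for \<sigma>'
      using Cons.prems(4)[folded V, OF that] by (simp add: xe ms)
    show "J (?B 0) (nupdate x [] 0 \<sigma>)"
      using Cons.prems(3,6) by (simp add: xe)
    fix k \<sigma>'
    assume k: "k < m" "nmem \<sigma>' x [] = k" and agr: "agree (insert x ?V) \<sigma>' \<sigma>" and J: "J (?B k) \<sigma>'"
    have trans: "agree (fst ` set (xe # l) \<union> V) \<tau> \<sigma>" if "agree ?V \<tau> \<sigma>'" for \<tau>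
      by (rule agree_trans[OF that agr]) (auto simp: xe)
    have "runs ?V (nest l c) \<sigma>' (nest_time ms' T) (J (?B k \<union> (#) k ` tuples ms'))"
    proof (rule Cons.IH[where J = "\<lambda>S. J (?B k \<union> (#) k ` S)"])
      show "distinct (map fst l)" "fst ` set l \<inter> V = {}" using Cons.prems(1,2) by auto
      show "J (?B k \<union> (#) k ` S) (nupdate y [] j \<tau>)"
        if "y \<in> fst ` set l" "J (?B k \<union> (#) k ` S) \<tau>" for y j S \<tau>
        using Cons.prems(3) that by simp
      show "map (\<lambda>(x, e). nval \<tau> e) l = ms'" if "agree ?V \<tau> \<sigma>'" for \<tau>
        using Cons.prems(4)[OF trans[OF that]] by (simp add: xe ms)
      show "J (?B k \<union> (#) k ` {}) \<sigma>'" using J by simp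
      fix \<tau> ks S
      assume *: "agree ?V \<tau> \<sigma>'" "map (\<lambda>(x, e). nmem \<tau> x []) l = ks" "ks \<in> tuples ms'"
        "S \<subseteq> tuples ms' - {ks}" "J (?B k \<union> (#) k ` S) \<tau>"
      have "nmem \<tau> x [] = k" using *(1) x k by (simp add: agree_def)
      then have "map (\<lambda>(x, e). nmem \<tau> x []) (xe # l) = k # ks" using *(2) by (simp add: xe)
      moreover have "k # ks \<in> tuples ms" using k *(3) by (simp add: ms tuples_def)
      moreover have "?B k \<union> (#) k ` S \<subseteq> tuples ms - {k # ks}"
        using k(1) *(4) by (force simp: ms tuples_def)
      ultimately have "runs V c \<tau> T (J (insert (k # ks) (?B k \<union> (#) k ` S)))"
        using *(5) by (rule Cons.prems(5)[OF trans[OF *(1)]])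
      then show "runs V c \<tau> T (J (?B k \<union> (#) k ` insert ks S))"
        by simp
    qed
    moreover have "?B k \<union> (#) k ` tuples ms' = ?B (Suc k)"
      by (auto simp: less_Suc_eq)
    ultimately show "runs ?V (nest l c) \<sigma>' (nest_time ms' T) (\<lambda>\<tau>. J (?B (Suc k)) (nupdate x [] (Suc k) \<tau>))"
      using Cons.prems(3) by (auto elim!: runs_weaken simp: xe)
  qed (rule x)
  moreover have "?B m = tuples ms"
    by (auto simp: ms tuples_def list_all2_Cons2)
  ultimately show ?case
    unfolding V by (simp add: xe ms)
qed

text \<open>As \<open>g\<close> is injective, the cell of a tuple still has its original value when
  its turn comes. The assigned expression may therefore read that cell, as an update in place
  does.\<close>

lemma runs_filled:
  assumes "distinct (map fst l)" "fst ` set l \<subseteq> V" and inj: "inj_on g (tuples ms)"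
    and bounds: "\<And>\<tau>. agree V \<tau> \<sigma> \<Longrightarrow> map (\<lambda>(x, e). nval \<tau> e) l = ms"
    and body: "\<And>\<tau>. let ks = map (\<lambda>(x, e). nmem \<tau> x []) l in agree V \<tau> \<sigma> \<longrightarrow> ks \<in> tuples ms \<longrightarrow>
      (\<forall>z. z \<noteq> A \<longrightarrow> fmem \<tau> z = fmem \<sigma> z) \<longrightarrow> fmem \<tau> A (g ks) = fmem \<sigma> A (g ks) \<longrightarrow>
      map (nval \<tau>) es = g ks \<and> fval \<tau> e = h ks"
  shows "runs V (nest l (FAssign A es e)) \<sigma> (nest_time ms 1) (filled A ms g h \<sigma>)"
proof -
  let ?J = "\<lambda>S \<tau>. (\<forall>z. z \<noteq> A \<longrightarrow> fmem \<tau> z = fmem \<sigma> z) \<and> (\<forall>ks\<in>S. fmem \<tau> A (g ks) = h ks) \<and>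
    (\<forall>is. is \<notin> g ` S \<longrightarrow> fmem \<tau> A is = fmem \<sigma> A is)"
  have sub: "agree V \<tau> \<sigma>" if "agree (fst ` set l \<union> {}) \<tau> \<sigma>" for \<tau>
    using that assms(2) by (auto simp: agree_def)
  have "runs (fst ` set l \<union> {}) (nest l (FAssign A es e)) \<sigma> (nest_time ms 1) (?J (tuples ms))"
  proof (rule runs_nest)
    show "map (\<lambda>(x, e). nval \<tau> e) l = ms" if "agree (fst ` set l \<union> {}) \<tau> \<sigma>" for \<tau>
      by (rule bounds[OF sub[OF that]])
    fix \<tau> ks S
    assume *: "agree (fst ` set l \<union> {}) \<tau> \<sigma>" "map (\<lambda>(x, e). nmem \<tau> x []) l = ks" "ks \<in> tuples ms"
      "S \<subseteq> tuples ms - {ks}" "?J S \<tau>"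
    have "g ks \<notin> g ` S" using inj *(3,4) by (auto simp: inj_on_def)
    then have other: "g ks' \<noteq> g ks" if "ks' \<in> S" for ks' using that by (metis imageI)
    have "fmem \<tau> A (g ks) = fmem \<sigma> A (g ks)" using *(5) \<open>g ks \<notin> g ` S\<close> by blast
    then have "map (nval \<tau>) es = g ks \<and> fval \<tau> e = h ks"
      using body[of \<tau>] sub[OF *(1)] *(2,3,5) unfolding Let_def by blast
    then show "runs {} (FAssign A es e) \<tau> 1 (?J (insert ks S))"
      using *(5) by (intro runs_FAssign) (simp add: fmem_fupdate other)
  qed (use assms(1) in auto)
  then show ?thesis
    using assms(2) by (rule_tac runs_weaken) (auto simp: filled_def)
qed

end

lemma tuples_iff: "ks \<in> tuples [] \<longleftrightarrow> ks = []"
  "ks \<in> tuples (m # ms) \<longleftrightarrow> (\<exists>k ks'. ks = k # ks' \<and> k < m \<and> ks' \<in> tuples ms)"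
  by (auto simp: tuples_def list_all2_Cons2)

lemma nest_time_mono:
  "list_all2 (\<le>) ms ms' \<Longrightarrow> T \<le> T' \<Longrightarrow> nest_time ms T \<le> nest_time ms' (T' :: nat)"
proof (induction ms ms' rule: list_all2_induct)
  case (Cons m ms m' ms')
  then show ?case unfolding nest_time.simps by (intro add_mono mult_le_mono) simp_all
qed simp

lemma poly_nest_time: "poly (nest_time ms T) x = nest_time (map (\<lambda>p. poly p x) ms) (poly T x)"
  by (induction ms) simp_all

lemma poly_nat_mono: "x \<le> y \<Longrightarrow> poly p x \<le> poly (p :: nat poly) y"
  by (induction p) (auto intro!: add_mono mult_le_mono)

text \<open>The program controls its array only at indices in \<open>R \<union> C\<close>.\<close>

lemma reduction_cong:
  assumes "\<And>x y. x \<in> R \<union> C \<Longrightarrow> y \<in> R \<union> C \<Longrightarrow> M x y = M' x y"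
  shows "reduction R C A M \<longleftrightarrow> reduction R C A M'"
proof -
  have 1: "M x v - (\<Sum>p\<in>R. M x p * A p v) = M' x v - (\<Sum>p\<in>R. M' x p * A p v)"
    if "x \<in> R \<union> C" "v \<in> C" for x v
    using that assms by (intro arg_cong2[of _ _ _ _ "(-)"] sum.cong) auto
  have 2: "M p y - (\<Sum>v\<in>C. A p v * M v y) = M' p y - (\<Sum>v\<in>C. A p v * M' v y)"
    if "p \<in> R" "y \<in> R \<union> C" for p y
    using that assms by (intro arg_cong2[of _ _ _ _ "(-)"] sum.cong) auto
  show ?thesis
    unfolding reduction_def
    by (intro arg_cong2[of _ _ _ _ "(\<and>)"] ball_cong refl arg_cong2[of _ _ _ _ "(=)"] 1 2)
qed

definition Mat :: "'a state \<Rightarrow> nat \<times> nat \<Rightarrow> nat \<times> nat \<Rightarrow> 'a" where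
  "Mat \<sigma> p q = fmem \<sigma> ''M'' [fst p, snd p, fst q, snd q]"

lemma Mat_nupdate: "Mat (nupdate x is m \<sigma>) = Mat \<sigma>"
  by (simp add: Mat_def fun_eq_iff)

section \<open>The learning program\<close>

abbreviation nv :: "vname \<Rightarrow> nexp" where
  "nv x \<equiv> NVar x []"

text \<open>A matrix index is a pair: \<open>(t, u)\<close> with a letter \<open>t < n\<close>
  stands for a row of the measured matrix, \<open>(n, v)\<close> for a column. So the first
  component has \<open>n + 1\<close> possible values.\<close>

abbreviation n1 :: nexp where
  "n1 \<equiv> NPlus (nv ''n'') (NConst 1)"

text \<open>On level \<open>i\<close> the value of \<open>off\<close> is \<open>i * s\<close>, and
  the current functionals occupy the \<open>s\<close> columns from there on; this is the first free
  one.\<close>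

abbreviation column :: "nexp" where
  "column \<equiv> NPlus (nv ''off'') (nv ''s'')"

text \<open>All inner levels get width \<open>s\<close>. Arc flags beyond the widths of the first
  and the last level are ignored by \<open>output_abp\<close>.\<close>

definition prep :: com where
  "prep = Seq (NAssign ''depth'' [] (nv ''d''))
    (Seq (nest [(''i'', nv ''d'')] (NAssign ''width'' [nv ''i''] (nv ''s'')))
    (Seq (NAssign ''width'' [NConst 0] (NConst 1))
    (Seq (NAssign ''width'' [nv ''d''] (NConst 1))
      (nest [(''i'', nv ''d''), (''u'', nv ''s''), (''v'', nv ''s'')]
        (NAssign ''arc'' [nv ''i'', nv ''u'', nv ''v''] (NConst 1))))))"

definition measure_body :: com where
  "measure_body =
    Seq (FAssign ''X'' [nv ''t'', NPlus (nv ''off'') (nv ''u''), column] FOne)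
    (Seq (Query ''Y'' (NPlus (nv ''i'') (NConst 1)) (nv ''v'') (NPlus column (NConst 1)) ''X'')
    (Seq (FAssign ''coeff'' [nv ''i'', nv ''u'', nv ''v'', nv ''t''] (FVar ''Y'' [NConst 0, column]))
      (FAssign ''X'' [nv ''t'', NPlus (nv ''off'') (nv ''u''), column] FZero)))"

definition measure_coeffs :: com where
  "measure_coeffs = nest [(''u'', nv ''s''), (''v'', nv ''s''), (''t'', nv ''n'')] measure_body"

definition init_matrix :: com where
  "init_matrix =
    Seq (nest [(''a'', n1), (''b'', nv ''s''), (''x'', n1), (''y'', nv ''s'')]
      (FAssign ''M'' [nv ''a'', nv ''b'', nv ''x'', nv ''y''] FZero))
    (Seq (nest [(''a'', n1), (''b'', nv ''s'')] (FAssign ''M'' [nv ''a'', nv ''b'', nv ''a'', nv ''b''] FOne))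
      (nest [(''a'', nv ''n''), (''b'', nv ''s''), (''y'', nv ''s'')]
        (FAssign ''M'' [nv ''a'', nv ''b'', nv ''n'', nv ''y'']
          (FVar ''coeff'' [nv ''i'', nv ''b'', nv ''y'', nv ''a'']))))"

text \<open>The multipliers and the pivot row are saved first because the update of \<open>M\<close>
  in place would overwrite them.\<close>

definition pivot_step :: com where
  "pivot_step =
    Seq (nest [(''x'', n1), (''y'', nv ''s'')] (FAssign ''col'' [nv ''x'', nv ''y'']
      (FDivide (FVar ''M'' [nv ''x'', nv ''y'', nv ''n'', nv ''q''])
        (FVar ''M'' [nv ''a'', nv ''b'', nv ''n'', nv ''q'']))))
    (Seq (nest [(''x'', n1), (''y'', nv ''s'')] (FAssign ''row'' [nv ''x'', nv ''y'']
      (FVar ''M'' [nv ''a'', nv ''b'', nv ''x'', nv ''y''])))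
    (nest [(''x'', n1), (''y'', nv ''s''), (''z'', n1), (''w'', nv ''s'')]
      (FAssign ''M'' [nv ''x'', nv ''y'', nv ''z'', nv ''w'']
        (FMinus (FVar ''M'' [nv ''x'', nv ''y'', nv ''z'', nv ''w''])
          (FTimes (FVar ''col'' [nv ''x'', nv ''y'']) (FVar ''row'' [nv ''z'', nv ''w'']))))))"

definition reduce_matrix :: com where
  "reduce_matrix = nest [(''a'', nv ''n''), (''b'', nv ''s'')] (nest [(''q'', nv ''s'')] pivot_step)"

text \<open>The block with rows in \<open>C\<close> and columns in \<open>R\<close> holds
  \<open>- G\<close>, hence the change of sign.\<close>

definition extend_functional :: com where
  "extend_functional = nest [(''a'', nv ''n''), (''b'', nv ''s''), (''y'', nv ''s'')]
    (FAssign ''X'' [nv ''a'', NPlus (nv ''off'') (nv ''b''), NPlus column (nv ''y'')]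
      (FMinus FZero (FVar ''M'' [nv ''n'', nv ''y'', nv ''a'', nv ''b''])))"

definition level :: com where
  "level = Seq measure_coeffs (Seq init_matrix (Seq reduce_matrix (Seq extend_functional
    (NAssign ''off'' [] column))))"

definition learn :: com where
  "learn = Seq prep (nest [(''i'', nv ''d'')] level)"

abbreviation Xf :: "'a state \<Rightarrow> nat \<Rightarrow> nat \<Rightarrow> nat \<Rightarrow> 'a" where
  "Xf \<sigma> t r c \<equiv> fmem \<sigma> ''X'' [t, r, c]"

section \<open>Correctness of the components of the program\<close>

locale learner = abp P + machine "blackbox_of P" K cost
  for P :: "'a::field abp" and K cost +
  fixes n s :: nat
  assumes n: "n = abp_nvars P" and s: "s = abp_size P"
begin

definition R :: "(nat \<times> nat) set" where "R = {..<n} \<times> {..<s}"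

definition C :: "(nat \<times> nat) set" where "C = {n} \<times> {..<s}"

lemma in_RC [simp]: "(a, b) \<in> R \<longleftrightarrow> a < n \<and> b < s" "(a, b) \<in> C \<longleftrightarrow> a = n \<and> b < s"
  by (auto simp: R_def C_def)

lemma in_RC_Un: "(a, b) \<in> R \<union> C \<longleftrightarrow> a \<le> n \<and> b < s"
  by auto

lemma runs_measure_coeffs:
  assumes env: "nmem \<sigma> ''n'' [] = n" "nmem \<sigma> ''s'' [] = s" "nmem \<sigma> ''i'' [] = i" "nmem \<sigma> ''off'' [] = i * s"
    and K: "Suc (i * s + s) \<le> K" and T: "cost (Suc (i * s + s)) \<le> T"
    and upper: "\<And>t r c. c \<le> r \<Longrightarrow> Xf \<sigma> t r c = 0"
    and new: "\<And>t r c. i * s + s \<le> c \<Longrightarrow> Xf \<sigma> t r c = 0"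
  shows "runs {''u'', ''v'', ''t''} measure_coeffs \<sigma> (nest_time [s, s, n] (T + 4)) (\<lambda>\<tau>.
    fmem \<tau> ''X'' = fmem \<sigma> ''X'' \<and>
    (\<forall>u<s. \<forall>v<s. \<forall>t<n. fmem \<tau> ''coeff'' [i, u, v, t] = measured (Xf \<sigma>) P i u v t) \<and>
    (\<forall>l u v t. l \<noteq> i \<longrightarrow> fmem \<tau> ''coeff'' [l, u, v, t] = fmem \<sigma> ''coeff'' [l, u, v, t]))"
proof -
  let ?l = "[(''u'', nv ''s''), (''v'', nv ''s''), (''t'', nv ''n'')]"
  let ?J = "\<lambda>S \<tau>. fmem \<tau> ''X'' = fmem \<sigma> ''X'' \<and>
    (\<forall>u v t. [u, v, t] \<in> S \<longrightarrow> fmem \<tau> ''coeff'' [i, u, v, t] = measured (Xf \<sigma>) P i u v t) \<and>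
    (\<forall>l u v t. l \<noteq> i \<longrightarrow> fmem \<tau> ''coeff'' [l, u, v, t] = fmem \<sigma> ''coeff'' [l, u, v, t])"
  have "runs (fst ` set ?l \<union> {}) measure_coeffs \<sigma> (nest_time [s, s, n] (T + 4)) (?J (tuples [s, s, n]))"
    unfolding measure_coeffs_def
  proof (rule runs_nest)
    show "map (\<lambda>(x, e). nval \<tau> e) ?l = [s, s, n]" if "agree (fst ` set ?l \<union> {}) \<tau> \<sigma>" for \<tau>
      using that env by (simp add: agree_def)
    fix \<tau> ks S
    assume *: "agree (fst ` set ?l \<union> {}) \<tau> \<sigma>" "map (\<lambda>(x, e). nmem \<tau> x []) ?l = ks" "ks \<in> tuples [s, s, n]"
      "S \<subseteq> tuples [s, s, n] - {ks}" "?J S \<tau>"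
    obtain u v t where ks: "ks = [u, v, t]" and lt: "u < s" "v < s" "t < n"
      using *(3) by (auto simp: tuples_iff)
    have env': "nmem \<tau> ''u'' [] = u" "nmem \<tau> ''v'' [] = v" "nmem \<tau> ''t'' [] = t"
      "nmem \<tau> ''s'' [] = s" "nmem \<tau> ''i'' [] = i" "nmem \<tau> ''off'' [] = i * s"
      using *(1,2) env by (simp_all add: ks agree_def)
    let ?c = "i * s + s"
    let ?\<tau>1 = "fupdate ''X'' [t, i * s + u, ?c] 1 \<tau>"
    let ?A = "blackbox_of P (Suc i) v (Suc ?c) (read_matrices ?\<tau>1 ''X'' (Suc ?c))"
    let ?\<tau>2 = "write_matrix ''Y'' (Suc ?c) ?A ?\<tau>1"
    let ?\<tau>3 = "fupdate ''coeff'' [i, u, v, t] (?A $$ (0, ?c)) ?\<tau>2"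
    let ?\<tau>4 = "fupdate ''X'' [t, i * s + u, ?c] 0 ?\<tau>3"
    have "read_matrices ?\<tau>1 ''X'' (Suc ?c) = (\<lambda>t'. mat (Suc ?c) (Suc ?c)
      (\<lambda>(r, c'). if t' = t \<and> r = i * s + u \<and> c' = ?c then 1 else Xf \<sigma> t' r c'))"
      using *(5) by (auto simp: read_matrices_def fmem_fupdate intro!: ext cong_mat)
    then have A: "?A $$ (0, ?c) = measured (Xf \<sigma>) P i u v t"
      using blackbox_measured[of u t "Xf \<sigma>" i v] lt upper new by (simp add: n s)
    have "runs {} measure_body \<tau> (1 + ((1 + T) + (1 + 1))) (\<lambda>\<upsilon>. \<upsilon> = ?\<tau>4)"
      unfolding measure_body_def
    proof (rule runs_Seq)
      show "runs {} (FAssign ''X'' [nv ''t'', NPlus (nv ''off'') (nv ''u''), column] FOne) \<tau> 1 (\<lambda>\<upsilon>. \<upsilon> = ?\<tau>1)"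
        by (rule runs_FAssign) (simp add: env')
    next
      fix \<upsilon> assume \<upsilon>: "\<upsilon> = ?\<tau>1"
      show "runs {} (Seq (Query ''Y'' (NPlus (nv ''i'') (NConst 1)) (nv ''v'') (NPlus column (NConst 1)) ''X'')
        (Seq (FAssign ''coeff'' [nv ''i'', nv ''u'', nv ''v'', nv ''t''] (FVar ''Y'' [NConst 0, column]))
        (FAssign ''X'' [nv ''t'', NPlus (nv ''off'') (nv ''u''), column] FZero))) \<upsilon>
        (1 + T + (1 + 1)) (\<lambda>\<upsilon>. \<upsilon> = ?\<tau>4)"
      proof (rule runs_Seq)
        show "runs {} (Query ''Y'' (NPlus (nv ''i'') (NConst 1)) (nv ''v'') (NPlus column (NConst 1)) ''X'') \<upsilon>
          (1 + T) (\<lambda>\<upsilon>. \<upsilon> = ?\<tau>2)"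
          by (rule runs_Query[where m = "Suc ?c"]) (use K T in \<open>simp_all add: \<upsilon> env'\<close>)
      next
        fix \<upsilon> assume \<upsilon>: "\<upsilon> = ?\<tau>2"
        show "runs {} (Seq (FAssign ''coeff'' [nv ''i'', nv ''u'', nv ''v'', nv ''t''] (FVar ''Y'' [NConst 0, column]))
          (FAssign ''X'' [nv ''t'', NPlus (nv ''off'') (nv ''u''), column] FZero)) \<upsilon>
          (1 + 1) (\<lambda>\<upsilon>. \<upsilon> = ?\<tau>4)"
        proof (rule runs_Seq)
          show "runs {} (FAssign ''coeff'' [nv ''i'', nv ''u'', nv ''v'', nv ''t''] (FVar ''Y'' [NConst 0, column])) \<upsilon>
            1 (\<lambda>\<upsilon>. \<upsilon> = ?\<tau>3)"
            by (rule runs_FAssign) (simp add: \<upsilon> env' fmem_write_matrix)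
        next
          fix \<upsilon> assume \<upsilon>: "\<upsilon> = ?\<tau>3"
          show "runs {} (FAssign ''X'' [nv ''t'', NPlus (nv ''off'') (nv ''u''), column] FZero) \<upsilon>
            1 (\<lambda>\<upsilon>. \<upsilon> = ?\<tau>4)"
            by (rule runs_FAssign) (simp add: \<upsilon> env')
        qed
      qed
    qed
    then show "runs {} measure_body \<tau> (T + 4) (?J (insert ks S))"
    proof (rule runs_weaken)
      fix \<upsilon> assume \<upsilon>: "\<upsilon> = ?\<tau>4"
      have "fmem ?\<tau>4 ''X'' = (fmem \<tau> ''X'')([t, i * s + u, ?c] := 0)"
        by (simp add: fmem_fupdate fmem_write_matrix_other)
      \<comment> \<open>The probed column was zero before, so writing 0 restores the array.\<close>
      also have "\<dots> = fmem \<tau> ''X''"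
        using *(5) new[of ?c t "i * s + u"] by (simp add: fun_upd_idem_iff)
      finally have "fmem \<upsilon> ''X'' = fmem \<sigma> ''X''" using *(5) \<upsilon> by simp
      moreover have "fmem \<upsilon> ''coeff'' = (fmem \<tau> ''coeff'')([i, u, v, t] := measured (Xf \<sigma>) P i u v t)"
        using A by (simp add: \<upsilon> fmem_fupdate fmem_write_matrix_other)
      ultimately show "?J (insert ks S) \<upsilon>"
        using *(5) by (simp add: ks)
    qed simp_all
  qed auto
  then show ?thesis
    by (rule runs_weaken) (auto simp: tuples_iff)
qed


lemma runs_init_matrix:
  assumes env: "nmem \<sigma> ''n'' [] = n" "nmem \<sigma> ''s'' [] = s" "nmem \<sigma> ''i'' [] = i"
  shows "runs {''a'', ''b'', ''x'', ''y''} init_matrix \<sigma>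
    (nest_time [n + 1, s, n + 1, s] 1 + (nest_time [n + 1, s] 1 + nest_time [n, s, s] 1)) (\<lambda>\<tau>.
      (\<forall>z. z \<noteq> ''M'' \<longrightarrow> fmem \<tau> z = fmem \<sigma> z) \<and>
      (\<forall>p\<in>R \<union> C. \<forall>q\<in>R \<union> C. Mat \<tau> p q =
        (if p \<in> R \<and> q \<in> C then fmem \<sigma> ''coeff'' [i, snd p, snd q, fst p] else if p = q then 1 else 0)))"
    (is "runs ?V _ _ _ ?Q")
proof -
  let ?g = "\<lambda>ks::nat list. [ks ! 0, ks ! 1, n, ks ! 2]"
  let ?h = "\<lambda>ks. fmem \<sigma> ''coeff'' [i, ks ! 1, ks ! 2, ks ! 0]"
  show ?thesis
    unfolding init_matrix_def
  proof (rule runs_Seq)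
    show "runs ?V (nest [(''a'', n1), (''b'', nv ''s''), (''x'', n1), (''y'', nv ''s'')]
      (FAssign ''M'' [nv ''a'', nv ''b'', nv ''x'', nv ''y''] FZero)) \<sigma> (nest_time [n + 1, s, n + 1, s] 1)
      (filled ''M'' [n + 1, s, n + 1, s] (\<lambda>ks. ks) (\<lambda>_. 0) \<sigma>)"
      by (rule runs_filled) (simp_all add: agree_def env Let_def)
  next
    fix \<sigma>1 assume agr: "agree ?V \<sigma>1 \<sigma>" and 1: "filled ''M'' [n + 1, s, n + 1, s] (\<lambda>ks. ks) (\<lambda>_. 0) \<sigma> \<sigma>1"
    then have env1: "nmem \<sigma>1 ''n'' [] = n" "nmem \<sigma>1 ''s'' [] = s" "nmem \<sigma>1 ''i'' [] = i"
      using env by (auto simp: agree_def)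
    have inj: "inj_on (\<lambda>ks. ks @ ks) (tuples [n + 1, s])"
      by (rule inj_on_inverseI[where g = "take 2"]) (auto simp: tuples_iff)
    show "runs ?V (Seq (nest [(''a'', n1), (''b'', nv ''s'')] (FAssign ''M'' [nv ''a'', nv ''b'', nv ''a'', nv ''b''] FOne))
      (nest [(''a'', nv ''n''), (''b'', nv ''s''), (''y'', nv ''s'')]
        (FAssign ''M'' [nv ''a'', nv ''b'', nv ''n'', nv ''y'']
          (FVar ''coeff'' [nv ''i'', nv ''b'', nv ''y'', nv ''a''])))) \<sigma>1 (nest_time [n + 1, s] 1 + nest_time [n, s, s] 1) ?Q"
    proof (rule runs_Seq)
      show "runs ?V (nest [(''a'', n1), (''b'', nv ''s'')] (FAssign ''M'' [nv ''a'', nv ''b'', nv ''a'', nv ''b''] FOne))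
        \<sigma>1 (nest_time [n + 1, s] 1) (filled ''M'' [n + 1, s] (\<lambda>ks. ks @ ks) (\<lambda>_. 1) \<sigma>1)"
        by (rule runs_filled)
          (use inj in \<open>simp_all add: agree_def env1 Let_def\<close>)
    next
      fix \<sigma>2 assume agr: "agree ?V \<sigma>2 \<sigma>1" and 2: "filled ''M'' [n + 1, s] (\<lambda>ks. ks @ ks) (\<lambda>_. 1) \<sigma>1 \<sigma>2"
      then have env2: "nmem \<sigma>2 ''n'' [] = n" "nmem \<sigma>2 ''s'' [] = s" "nmem \<sigma>2 ''i'' [] = i"
        using env1 by (auto simp: agree_def)
      have coeff: "fmem \<sigma>2 ''coeff'' = fmem \<sigma> ''coeff''"
        using filledD(1)[OF 1] filledD(1)[OF 2] by simp
      have "runs {''a'', ''b'', ''y''} (nest [(''a'', nv ''n''), (''b'', nv ''s''), (''y'', nv ''s'')]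
        (FAssign ''M'' [nv ''a'', nv ''b'', nv ''n'', nv ''y'']
          (FVar ''coeff'' [nv ''i'', nv ''b'', nv ''y'', nv ''a'']))) \<sigma>2 (nest_time [n, s, s] 1)
        (filled ''M'' [n, s, s] ?g ?h \<sigma>2)"
      proof (rule runs_filled)
        show "inj_on ?g (tuples [n, s, s])"
          by (rule inj_on_inverseI[where g = "\<lambda>is. [is ! 0, is ! 1, is ! 3]"]) (auto simp: tuples_iff)
      qed (simp_all add: agree_def env2 coeff Let_def)
      then show "runs ?V (nest [(''a'', nv ''n''), (''b'', nv ''s''), (''y'', nv ''s'')]
        (FAssign ''M'' [nv ''a'', nv ''b'', nv ''n'', nv ''y'']
          (FVar ''coeff'' [nv ''i'', nv ''b'', nv ''y'', nv ''a'']))) \<sigma>2 (nest_time [n, s, s] 1) ?Q"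
      proof (rule runs_weaken)
        fix \<tau> assume 3: "filled ''M'' [n, s, s] ?g ?h \<sigma>2 \<tau>"
        \<comment> \<open>The cases are told apart by which of the three passes wrote the entry
          last: the measured block, the diagonal, or the zeros.\<close>
        have "Mat \<tau> (a, b) (x, y) = (if a < n \<and> x = n then fmem \<sigma> ''coeff'' [i, b, y, a]
            else if a = x \<and> b = y then 1 else 0)" if "a \<le> n" "x \<le> n" "b < s" "y < s" for a b x y
        proof (cases "a < n \<and> x = n")
          case True
          then show ?thesis
            using filledD(2)[OF 3, of "[a, b, y]"] that by (simp add: Mat_def tuples_iff)
        next
          case False
          then have *: "Mat \<tau> (a, b) (x, y) = fmem \<sigma>2 ''M'' [a, b, x, y]"
            unfolding Mat_def using that by (auto simp: tuples_iff intro!: filledD(3)[OF 3])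
          show ?thesis
          proof (cases "a = x \<and> b = y")
            case True
            then show ?thesis
              using filledD(2)[OF 2, of "[a, b]"] that False * by (auto simp: tuples_iff)
          next
            case neq: False
            then have "fmem \<sigma>2 ''M'' [a, b, x, y] = fmem \<sigma>1 ''M'' [a, b, x, y]"
              by (auto simp: tuples_iff intro!: filledD(3)[OF 2])
            then show ?thesis
              using filledD(2)[OF 1, of "[a, b, x, y]"] that False neq * by (auto simp: tuples_iff)
          qed
        qed
        then have "\<forall>p\<in>R \<union> C. \<forall>q\<in>R \<union> C. Mat \<tau> p q =
            (if p \<in> R \<and> q \<in> C then fmem \<sigma> ''coeff'' [i, snd p, snd q, fst p] else if p = q then 1 else 0)"
          by (auto split: if_splits)
        then show "?Q \<tau>"
          using filledD(1)[OF 1] filledD(1)[OF 2] filledD(1)[OF 3] by simp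
      qed auto
    qed
  qed
qed

lemma runs_pivot_step:
  assumes env: "nmem \<sigma> ''n'' [] = n" "nmem \<sigma> ''s'' [] = s"
    "nmem \<sigma> ''a'' [] = a" "nmem \<sigma> ''b'' [] = b" "nmem \<sigma> ''q'' [] = q"
  shows "runs {''x'', ''y'', ''z'', ''w''} pivot_step \<sigma>
    (nest_time [n + 1, s] 1 + (nest_time [n + 1, s] 1 + nest_time [n + 1, s, n + 1, s] 1)) (\<lambda>\<tau>.
      (\<forall>z. z \<notin> {''col'', ''row'', ''M''} \<longrightarrow> fmem \<tau> z = fmem \<sigma> z) \<and>
      (\<forall>x\<in>R \<union> C. \<forall>y\<in>R \<union> C. Mat \<tau> x y = pivot (a, b) (n, q) (Mat \<sigma>) x y))"
    (is "runs ?V _ _ _ ?Q")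
proof -
  let ?col = "\<lambda>ks. Mat \<sigma> (ks ! 0, ks ! 1) (n, q) / Mat \<sigma> (a, b) (n, q)"
  let ?row = "\<lambda>ks. Mat \<sigma> (a, b) (ks ! 0, ks ! 1)"
  let ?h = "\<lambda>ks. Mat \<sigma> (ks ! 0, ks ! 1) (ks ! 2, ks ! 3) - ?col ks * ?row (drop 2 ks)"
  show ?thesis
    unfolding pivot_step_def
  proof (rule runs_Seq)
    show "runs ?V (nest [(''x'', n1), (''y'', nv ''s'')] (FAssign ''col'' [nv ''x'', nv ''y'']
      (FDivide (FVar ''M'' [nv ''x'', nv ''y'', nv ''n'', nv ''q''])
        (FVar ''M'' [nv ''a'', nv ''b'', nv ''n'', nv ''q''])))) \<sigma> (nest_time [n + 1, s] 1)
      (filled ''col'' [n + 1, s] (\<lambda>ks. ks) ?col \<sigma>)"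
      by (rule runs_filled) (simp_all add: agree_def env Mat_def Let_def)
  next
    fix \<sigma>1 assume agr: "agree ?V \<sigma>1 \<sigma>" and 1: "filled ''col'' [n + 1, s] (\<lambda>ks. ks) ?col \<sigma> \<sigma>1"
    then have env1: "nmem \<sigma>1 ''n'' [] = n" "nmem \<sigma>1 ''s'' [] = s"
        "nmem \<sigma>1 ''a'' [] = a" "nmem \<sigma>1 ''b'' [] = b" "nmem \<sigma>1 ''q'' [] = q"
      using env by (auto simp: agree_def)
    have M1: "fmem \<sigma>1 ''M'' = fmem \<sigma> ''M''" using filledD(1)[OF 1] by simp
    show "runs ?V (Seq (nest [(''x'', n1), (''y'', nv ''s'')] (FAssign ''row'' [nv ''x'', nv ''y'']
        (FVar ''M'' [nv ''a'', nv ''b'', nv ''x'', nv ''y''])))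
      (nest [(''x'', n1), (''y'', nv ''s''), (''z'', n1), (''w'', nv ''s'')]
        (FAssign ''M'' [nv ''x'', nv ''y'', nv ''z'', nv ''w'']
          (FMinus (FVar ''M'' [nv ''x'', nv ''y'', nv ''z'', nv ''w''])
            (FTimes (FVar ''col'' [nv ''x'', nv ''y'']) (FVar ''row'' [nv ''z'', nv ''w'']))))))
      \<sigma>1 (nest_time [n + 1, s] 1 + nest_time [n + 1, s, n + 1, s] 1) ?Q"
    proof (rule runs_Seq)
      show "runs ?V (nest [(''x'', n1), (''y'', nv ''s'')] (FAssign ''row'' [nv ''x'', nv ''y'']
          (FVar ''M'' [nv ''a'', nv ''b'', nv ''x'', nv ''y'']))) \<sigma>1 (nest_time [n + 1, s] 1)
        (filled ''row'' [n + 1, s] (\<lambda>ks. ks) ?row \<sigma>1)"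
        by (rule runs_filled) (simp_all add: agree_def env1 Mat_def M1 Let_def)
    next
      fix \<sigma>2 assume agr: "agree ?V \<sigma>2 \<sigma>1" and 2: "filled ''row'' [n + 1, s] (\<lambda>ks. ks) ?row \<sigma>1 \<sigma>2"
      then have env2: "nmem \<sigma>2 ''n'' [] = n" "nmem \<sigma>2 ''s'' [] = s"
        using env1 by (auto simp: agree_def)
      have M2: "fmem \<sigma>2 ''M'' = fmem \<sigma> ''M''" using filledD(1)[OF 2] M1 by simp
      have col: "fmem \<sigma>2 ''col'' [x, y] = ?col [x, y]" and row: "fmem \<sigma>2 ''row'' [x, y] = ?row [x, y]"
        if "x < n + 1" "y < s" for x y
        using that filledD(1)[OF 2, of "''col''"] filledD(2)[OF 1, of "[x, y]"] filledD(2)[OF 2, of "[x, y]"]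
        by (simp_all add: tuples_iff)
      have "runs ?V (nest [(''x'', n1), (''y'', nv ''s''), (''z'', n1), (''w'', nv ''s'')]
        (FAssign ''M'' [nv ''x'', nv ''y'', nv ''z'', nv ''w'']
          (FMinus (FVar ''M'' [nv ''x'', nv ''y'', nv ''z'', nv ''w''])
            (FTimes (FVar ''col'' [nv ''x'', nv ''y'']) (FVar ''row'' [nv ''z'', nv ''w''])))))
        \<sigma>2 (nest_time [n + 1, s, n + 1, s] 1) (filled ''M'' [n + 1, s, n + 1, s] (\<lambda>ks. ks) ?h \<sigma>2)"
        by (rule runs_filled)
          (simp_all add: agree_def env2 tuples_iff Mat_def M2 col row Let_def numeral_3_eq_3)
      then show "runs ?V (nest [(''x'', n1), (''y'', nv ''s''), (''z'', n1), (''w'', nv ''s'')]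
        (FAssign ''M'' [nv ''x'', nv ''y'', nv ''z'', nv ''w'']
          (FMinus (FVar ''M'' [nv ''x'', nv ''y'', nv ''z'', nv ''w''])
            (FTimes (FVar ''col'' [nv ''x'', nv ''y'']) (FVar ''row'' [nv ''z'', nv ''w''])))))
        \<sigma>2 (nest_time [n + 1, s, n + 1, s] 1) ?Q"
      proof (rule runs_weaken)
        fix \<tau> assume 3: "filled ''M'' [n + 1, s, n + 1, s] (\<lambda>ks. ks) ?h \<sigma>2 \<tau>"
        have "Mat \<tau> (x, y) (z, w) = pivot (a, b) (n, q) (Mat \<sigma>) (x, y) (z, w)"
          if "x \<le> n" "y < s" "z \<le> n" "w < s" for x y z w
          using filledD(2)[OF 3, of "[x, y, z, w]"] that
          by (simp add: tuples_iff pivot_def Mat_def[of \<tau>] numeral_3_eq_3)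
        then show "?Q \<tau>"
          using filledD(1)[OF 1] filledD(1)[OF 2] filledD(1)[OF 3] by (auto simp: in_RC_Un simp del: Un_iff)
      qed auto
    qed
  qed
qed

text \<open>A nonzero pivot clears its whole row, and a zero one changes nothing, so after all
  columns have been tried the row vanishes on \<open>C\<close>. Rows cleared earlier stay zero there
  because their multipliers are 0.\<close>

lemma runs_reduce_matrix:
  assumes env: "nmem \<sigma> ''n'' [] = n" "nmem \<sigma> ''s'' [] = s" and red: "reduction R C A (Mat \<sigma>)"
  shows "runs {''a'', ''b'', ''q'', ''x'', ''y'', ''z'', ''w''} reduce_matrix \<sigma>
    (nest_time [n, s] (nest_time [s]
      (nest_time [n + 1, s] 1 + (nest_time [n + 1, s] 1 + nest_time [n + 1, s, n + 1, s] 1)))) (\<lambda>\<tau>.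
      (\<forall>z. z \<notin> {''col'', ''row'', ''M''} \<longrightarrow> fmem \<tau> z = fmem \<sigma> z) \<and>
      reduction R C A (Mat \<tau>) \<and> (\<forall>p\<in>R. \<forall>v\<in>C. Mat \<tau> p v = 0))"
proof -
  let ?l = "[(''a'', nv ''n''), (''b'', nv ''s'')]" and ?l' = "[(''q'', nv ''s'')]"
  let ?T = "nest_time [n + 1, s] 1 + (nest_time [n + 1, s] 1 + nest_time [n + 1, s, n + 1, s] 1)"
  let ?V = "{''x'', ''y'', ''z'', ''w''}"
  let ?I = "\<lambda>\<tau>. (\<forall>z. z \<notin> {''col'', ''row'', ''M''} \<longrightarrow> fmem \<tau> z = fmem \<sigma> z) \<and> reduction R C A (Mat \<tau>)"
  let ?J = "\<lambda>S \<tau>. ?I \<tau> \<and> (\<forall>a b. [a, b] \<in> S \<longrightarrow> (\<forall>v\<in>C. Mat \<tau> (a, b) v = 0))"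
  have "runs (fst ` set ?l \<union> insert ''q'' ?V) (nest ?l (nest ?l' pivot_step)) \<sigma>
    (nest_time [n, s] (nest_time [s] ?T)) (?J (tuples [n, s]))"
  proof (rule runs_nest[where J = ?J])
    show "map (\<lambda>(x, e). nval \<tau> e) ?l = [n, s]" if "agree (fst ` set ?l \<union> insert ''q'' ?V) \<tau> \<sigma>" for \<tau>
      using that env by (simp add: agree_def)
    show "?J {} \<sigma>" using red by simp
    fix \<tau> ks S
    assume *: "agree (fst ` set ?l \<union> insert ''q'' ?V) \<tau> \<sigma>" "map (\<lambda>(x, e). nmem \<tau> x []) ?l = ks"
      "ks \<in> tuples [n, s]" "S \<subseteq> tuples [n, s] - {ks}" "?J S \<tau>"
    obtain a b where ks: "ks = [a, b]" and lt: "a < n" "b < s" using *(3) by (auto simp: tuples_iff)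
    have S: "a' < n \<and> b' < s" if "[a', b'] \<in> S" for a' b'
      using that *(4) by (auto simp: tuples_iff)
    have env': "nmem \<tau> ''a'' [] = a" "nmem \<tau> ''b'' [] = b" "nmem \<tau> ''n'' [] = n" "nmem \<tau> ''s'' [] = s"
      using *(1,2) env by (simp_all add: ks agree_def)
    \<comment> \<open>\<open>S\<close> collects the finished rows, \<open>S'\<close> the columns
      tried in the current row.\<close>
    let ?J' = "\<lambda>S' \<upsilon>. ?J S \<upsilon> \<and> (\<forall>q. [q] \<in> S' \<longrightarrow> Mat \<upsilon> (a, b) (n, q) = 0)"
    have "runs (fst ` set ?l' \<union> ?V) (nest ?l' pivot_step) \<tau> (nest_time [s] ?T) (?J' (tuples [s]))"
    proof (rule runs_nest[where J = ?J'])
      show "map (\<lambda>(x, e). nval \<upsilon> e) ?l' = [s]" if "agree (fst ` set ?l' \<union> ?V) \<upsilon> \<tau>" for \<upsilon>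
        using that env' by (simp add: agree_def)
      show "?J' {} \<tau>" using *(5) by simp
      fix \<upsilon> ks' S'
      assume **: "agree (fst ` set ?l' \<union> ?V) \<upsilon> \<tau>" "map (\<lambda>(x, e). nmem \<upsilon> x []) ?l' = ks'"
        "ks' \<in> tuples [s]" "S' \<subseteq> tuples [s] - {ks'}" "?J' S' \<upsilon>"
      obtain q where ks': "ks' = [q]" and q: "q < s" using **(3) by (auto simp: tuples_iff)
      have S': "q' < s" if "[q'] \<in> S'" for q'
        using that **(4) by (auto simp: tuples_iff)
      have env'': "nmem \<upsilon> ''n'' [] = n" "nmem \<upsilon> ''s'' [] = s"
        "nmem \<upsilon> ''a'' [] = a" "nmem \<upsilon> ''b'' [] = b" "nmem \<upsilon> ''q'' [] = q"
        using **(1,2) env' by (simp_all add: ks' agree_def)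
      show "runs ?V pivot_step \<upsilon> ?T (?J' (insert ks' S'))"
      proof (rule runs_weaken[OF runs_pivot_step[OF env'']])
        fix \<omega>
        let ?M' = "pivot (a, b) (n, q) (Mat \<upsilon>)"
        assume \<omega>: "(\<forall>z. z \<notin> {''col'', ''row'', ''M''} \<longrightarrow> fmem \<omega> z = fmem \<upsilon> z) \<and>
          (\<forall>x\<in>R \<union> C. \<forall>y\<in>R \<union> C. Mat \<omega> x y = ?M' x y)"
        have "reduction R C A ?M'"
          using **(5) lt q by (intro reduction_pivot) (auto simp: R_def C_def)
        then have red': "reduction R C A (Mat \<omega>)"
          using \<omega> reduction_cong[of R C "Mat \<omega>" ?M' A] by simp
        have zero: "Mat \<omega> (a', b') v = 0" if "[a', b'] \<in> S" "v \<in> C" for a' b' v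
        proof -
          have "Mat \<upsilon> (a', b') (n, q) = 0" "Mat \<upsilon> (a', b') v = 0"
            using **(5) that q by auto
          then show ?thesis
            using \<omega> S[OF that(1)] that(2) by (simp add: pivot_def)
        qed
        have row: "Mat \<omega> (a, b) (n, q') = 0" if "q' = q \<or> [q'] \<in> S'" for q'
        proof -
          have q': "q' < s" using that q S'[of q'] by metis
          have "?M' (a, b) (n, q') = 0"
          proof (cases "Mat \<upsilon> (a, b) (n, q) = 0")
            case True
            have "\<forall>q. [q] \<in> S' \<longrightarrow> Mat \<upsilon> (a, b) (n, q) = 0" using **(5) by (rule conjunct2)
            then have "Mat \<upsilon> (a, b) (n, q') = 0" using that True by metis
            then show ?thesis using True by (simp add: pivot_eq_if_pivot_0)
          next
            case False
            then show ?thesis by (rule pivot_row_eq_0)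
          qed
          then show ?thesis using \<omega> q' lt by simp
        qed
        show "?J' (insert ks' S') \<omega>"
        proof (intro conjI allI impI ballI)
          have "\<forall>z. z \<notin> {''col'', ''row'', ''M''} \<longrightarrow> fmem \<upsilon> z = fmem \<sigma> z"
            using **(5) by (elim conjE)
          then show "fmem \<omega> z = fmem \<sigma> z" if "z \<notin> {''col'', ''row'', ''M''}" for z
            using \<omega> that by metis
          show "Mat \<omega> (a, b) (n, q') = 0" if "[q'] \<in> insert ks' S'" for q'
            using that by (intro row) (simp add: ks')
          show "reduction R C A (Mat \<omega>)" by (rule red')
          show "Mat \<omega> (a', b') v = 0" if "[a', b'] \<in> S" "v \<in> C" for a' b' v
            using that by (rule zero)
        qed
      qed auto
    qed (simp_all add: Mat_nupdate)
    then show "runs (insert ''q'' ?V) (nest ?l' pivot_step) \<tau> (nest_time [s] ?T) (?J (insert ks S))"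
      by (rule runs_weaken) (auto simp: tuples_iff ks C_def)
  qed (simp_all add: Mat_nupdate)
  then show ?thesis
    unfolding reduce_matrix_def
    by (rule runs_weaken) (auto simp: tuples_iff R_def)
qed

lemma runs_extend_functional:
  assumes env: "nmem \<sigma> ''n'' [] = n" "nmem \<sigma> ''s'' [] = s" "nmem \<sigma> ''off'' [] = i * s"
  shows "runs {''a'', ''b'', ''y''} extend_functional \<sigma> (nest_time [n, s, s] 1) (\<lambda>\<tau>.
    (\<forall>z. z \<noteq> ''X'' \<longrightarrow> fmem \<tau> z = fmem \<sigma> z) \<and>
    (\<forall>t r c. Xf \<tau> t r c = (if t < n \<and> i * s \<le> r \<and> r < i * s + s \<and> i * s + s \<le> c \<and> c < i * s + s + s
      then - Mat \<sigma> (n, c - (i * s + s)) (t, r - i * s) else Xf \<sigma> t r c)))"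
proof -
  let ?g = "\<lambda>ks::nat list. [ks ! 0, i * s + ks ! 1, i * s + s + ks ! 2]"
  let ?h = "\<lambda>ks. - Mat \<sigma> (n, ks ! 2) (ks ! 0, ks ! 1)"
  have "runs {''a'', ''b'', ''y''} extend_functional \<sigma> (nest_time [n, s, s] 1) (filled ''X'' [n, s, s] ?g ?h \<sigma>)"
    unfolding extend_functional_def
  proof (rule runs_filled)
    show "inj_on ?g (tuples [n, s, s])"
      by (rule inj_on_inverseI[where g = "\<lambda>is. [is ! 0, is ! 1 - i * s, is ! 2 - (i * s + s)]"])
        (auto simp: tuples_iff)
  qed (simp_all add: agree_def env Mat_def Let_def)
  then show ?thesis
  proof (rule runs_weaken)
    fix \<tau> assume \<tau>: "filled ''X'' [n, s, s] ?g ?h \<sigma> \<tau>"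
    have "Xf \<tau> t r c = (if t < n \<and> i * s \<le> r \<and> r < i * s + s \<and> i * s + s \<le> c \<and> c < i * s + s + s
      then - Mat \<sigma> (n, c - (i * s + s)) (t, r - i * s) else Xf \<sigma> t r c)" for t r c
    proof (cases "t < n \<and> i * s \<le> r \<and> r < i * s + s \<and> i * s + s \<le> c \<and> c < i * s + s + s")
      case True
      then have "[t, r - i * s, c - (i * s + s)] \<in> tuples [n, s, s]"
        by (simp add: tuples_iff) linarith
      then show ?thesis
        using filledD(2)[OF \<tau>, of "[t, r - i * s, c - (i * s + s)]" "[t, r, c]"] True by simp
    next
      case False
      then have "Xf \<tau> t r c = Xf \<sigma> t r c"
        by (intro filledD(3)[OF \<tau>]) (auto simp: tuples_iff)
      then show ?thesis unfolding if_not_P[OF False] .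
    qed
    then show "(\<forall>z. z \<noteq> ''X'' \<longrightarrow> fmem \<tau> z = fmem \<sigma> z) \<and>
      (\<forall>t r c. Xf \<tau> t r c = (if t < n \<and> i * s \<le> r \<and> r < i * s + s \<and> i * s + s \<le> c \<and> c < i * s + s + s
        then - Mat \<sigma> (n, c - (i * s + s)) (t, r - i * s) else Xf \<sigma> t r c))"
      using filledD(1)[OF \<tau>] by blast
  qed auto
qed

end

section \<open>Running time\<close>

definition prep_time :: "'t::comm_semiring_1 \<Rightarrow> 't \<Rightarrow> 't" where
  "prep_time d s = 1 + (nest_time [d] 1 + (1 + (1 + nest_time [d, s, s] 1)))"

text \<open>The summands follow the commands of \<open>level\<close>. The term \<open>T + 4\<close>
  stands for three assignments and a query of time \<open>1 + T\<close>.\<close>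

definition level_time :: "'t::comm_semiring_1 \<Rightarrow> 't \<Rightarrow> 't \<Rightarrow> 't" where
  "level_time n s T = nest_time [s, s, n] (T + 4) +
    ((nest_time [n + 1, s, n + 1, s] 1 + (nest_time [n + 1, s] 1 + nest_time [n, s, s] 1)) +
    (nest_time [n, s] (nest_time [s]
      (nest_time [n + 1, s] 1 + (nest_time [n + 1, s] 1 + nest_time [n + 1, s, n + 1, s] 1))) +
    (nest_time [n, s, s] 1 + 1)))"

definition learn_time :: "'t::comm_semiring_1 \<Rightarrow> 't \<Rightarrow> 't \<Rightarrow> 't \<Rightarrow> 't" where
  "learn_time n d s T = prep_time d s + (d * (level_time n s T + 2) + 2)"

text \<open>The formula read over \<open>nat poly\<close> is thus a polynomial whose values are the
  time bounds.\<close>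

lemma poly_learn_time:
  "poly (learn_time n d s T) x = learn_time (poly n x) (poly d x) (poly s x) (poly T x)"
  by (simp add: learn_time_def prep_time_def level_time_def poly_nest_time)

lemma learn_time_mono:
  fixes n :: nat
  assumes "n \<le> n'" "d \<le> d'" "s \<le> s'"
  shows "learn_time n d s T \<le> learn_time n' d' s' T"
  unfolding learn_time_def prep_time_def level_time_def
  by (intro add_mono mult_le_mono nest_time_mono) (use assms in simp_all)

section \<open>One level of the program\<close>

context learner
begin

text \<open>This unfolds the pair indices into the form of the hypothesis \<open>G\<close> of
  \<open>spanning_Suc\<close>.\<close>

lemma generalized_inverse_R_C:
  fixes A :: "nat \<Rightarrow> nat \<Rightarrow> nat \<Rightarrow> 'a"
  assumes "reduction R C (\<lambda>p v. A (snd p) (snd v) (fst p)) M"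
    and "\<And>p v. p \<in> R \<Longrightarrow> v \<in> C \<Longrightarrow> M p v = 0" and "u < s" "v < s" "t < n"
  shows "A u v t = (\<Sum>u'<s. A u u' t * (\<Sum>u2<s. \<Sum>t2<n. - M (n, u') (t2, u2) * A u2 v t2))"
proof -
  have "finite R" "finite C" "R \<inter> C = {}" by (auto simp: R_def C_def)
  then have "A u v t = (\<Sum>x\<in>C. A u (snd x) t * (\<Sum>p\<in>R. - M x p * A (snd p) v (fst p)))"
    using reduction_generalized_inverse[OF _ _ _ assms(1,2), of "(t, u)" "(n, v)"] assms(3-5) by simp
  also have "\<dots> = (\<Sum>u'<s. A u u' t * (\<Sum>p\<in>R. - M (n, u') p * A (snd p) v (fst p)))"
  proof -
    have "C = Pair n ` {..<s}" by (auto simp: C_def)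
    then show ?thesis by (simp add: sum.reindex inj_on_def)
  qed
  also have "\<dots> = (\<Sum>u'<s. A u u' t * (\<Sum>u2<s. \<Sum>t2<n. - M (n, u') (t2, u2) * A u2 v t2))"
  proof (intro sum.cong refl arg_cong2[of _ _ _ _ "(*)"])
    fix u'
    have "(\<Sum>p\<in>R. - M (n, u') p * A (snd p) v (fst p)) = (\<Sum>t2<n. \<Sum>u2<s. - M (n, u') (t2, u2) * A u2 v t2)"
      unfolding R_def by (simp add: sum.cartesian_product case_prod_unfold)
    then show "(\<Sum>p\<in>R. - M (n, u') p * A (snd p) v (fst p)) = (\<Sum>u2<s. \<Sum>t2<n. - M (n, u') (t2, u2) * A u2 v t2)"
      by (simp only: sum.swap[of _ "{..<s}"])
  qed
  finally show ?thesis .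
qed

text \<open>The zero columns from \<open>i * s + s\<close> on leave room for the probe entry and the
  next functionals. The last conjunct is the hypothesis \<open>coeff\<close> of
  \<open>output_abp_correct\<close> for the levels already done.\<close>

definition invariant :: "nat \<Rightarrow> 'a state \<Rightarrow> bool" where
  "invariant i \<sigma> \<longleftrightarrow> nmem \<sigma> ''off'' [] = i * s \<and>
    (\<forall>t r c. c \<le> r \<or> i * s + s \<le> c \<longrightarrow> Xf \<sigma> t r c = 0) \<and> spanning (Xf \<sigma>) P i \<and>
    (\<forall>l<i. \<forall>w\<in>words n l. \<forall>t<n. \<forall>v<s. gate_coeff P (Suc l) v (w @ [t]) =
      (\<Sum>u<s. gate_coeff P l u w * fmem \<sigma> ''coeff'' [l, u, v, t]))"

abbreviation level_vars :: "vname set" where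
  "level_vars \<equiv> {''u'', ''v'', ''t'', ''a'', ''b'', ''q'', ''x'', ''y'', ''z'', ''w'', ''off''}"

lemma runs_level:
  assumes env: "nmem \<sigma> ''n'' [] = n" "nmem \<sigma> ''s'' [] = s" "nmem \<sigma> ''i'' [] = i"
    and inv: "invariant i \<sigma>"
    and K: "Suc (i * s + s) \<le> K" and T: "cost (Suc (i * s + s)) \<le> T"
  shows "runs level_vars level \<sigma> (level_time n s T) (invariant (Suc i))"
  unfolding level_def level_time_def
proof (rule runs_Seq)
  have off: "nmem \<sigma> ''off'' [] = i * s" and span: "spanning (Xf \<sigma>) P i"
    and zero: "\<And>t r c. c \<le> r \<or> i * s + s \<le> c \<Longrightarrow> Xf \<sigma> t r c = 0"
    using inv unfolding invariant_def by blast+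
  let ?m = "measured (Xf \<sigma>) P i"
  let ?A = "\<lambda>p v. ?m (snd p) (snd v) (fst p)"
  \<comment> \<open>The frame \<open>level_vars\<close> contains \<open>off\<close> because of the
    final assignment, so each intermediate condition has to carry its value along.\<close>
  let ?Q1 = "\<lambda>\<tau>. nmem \<tau> ''off'' [] = i * s \<and> fmem \<tau> ''X'' = fmem \<sigma> ''X'' \<and>
    (\<forall>u<s. \<forall>v<s. \<forall>t<n. fmem \<tau> ''coeff'' [i, u, v, t] = ?m u v t) \<and>
    (\<forall>l u v t. l \<noteq> i \<longrightarrow> fmem \<tau> ''coeff'' [l, u, v, t] = fmem \<sigma> ''coeff'' [l, u, v, t])"
  show "runs level_vars measure_coeffs \<sigma> (nest_time [s, s, n] (T + 4)) ?Q1"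
    by (rule runs_weaken[OF runs_measure_coeffs[OF env off K T]]) (use zero off in \<open>auto simp: agree_def\<close>)
  fix \<sigma>1 assume agr1: "agree level_vars \<sigma>1 \<sigma>" and 1: "?Q1 \<sigma>1"
  have env1: "nmem \<sigma>1 ''n'' [] = n" "nmem \<sigma>1 ''s'' [] = s" "nmem \<sigma>1 ''i'' [] = i"
    using agr1 env by (simp_all add: agree_def)
  let ?Q2 = "\<lambda>\<tau>. nmem \<tau> ''off'' [] = i * s \<and> fmem \<tau> ''X'' = fmem \<sigma> ''X'' \<and> fmem \<tau> ''coeff'' = fmem \<sigma>1 ''coeff'' \<and> reduction R C ?A (Mat \<tau>)"
  show "runs level_vars (Seq init_matrix (Seq reduce_matrix (Seq extend_functional (NAssign ''off'' [] column)))) \<sigma>1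
    ((nest_time [n + 1, s, n + 1, s] 1 + (nest_time [n + 1, s] 1 + nest_time [n, s, s] 1)) +
    (nest_time [n, s] (nest_time [s]
      (nest_time [n + 1, s] 1 + (nest_time [n + 1, s] 1 + nest_time [n + 1, s, n + 1, s] 1))) +
    (nest_time [n, s, s] 1 + 1))) (invariant (Suc i))"
  proof (rule runs_Seq)
    show "runs level_vars init_matrix \<sigma>1
      (nest_time [n + 1, s, n + 1, s] 1 + (nest_time [n + 1, s] 1 + nest_time [n, s, s] 1)) ?Q2"
    proof (rule runs_weaken[OF runs_init_matrix[OF env1]])
      fix \<tau> assume "agree {''a'', ''b'', ''x'', ''y''} \<tau> \<sigma>1"
      then have "nmem \<tau> ''off'' [] = i * s" using 1 by (simp add: agree_def)
      moreover
      assume \<tau>: "(\<forall>z. z \<noteq> ''M'' \<longrightarrow> fmem \<tau> z = fmem \<sigma>1 z) \<and>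
        (\<forall>p\<in>R \<union> C. \<forall>q\<in>R \<union> C. Mat \<tau> p q =
          (if p \<in> R \<and> q \<in> C then fmem \<sigma>1 ''coeff'' [i, snd p, snd q, fst p] else if p = q then 1 else 0))"
      moreover have "reduction R C ?A (Mat \<tau>)"
      proof (rule reduction_init)
        show "finite R" "finite C" "R \<inter> C = {}" by (auto simp: R_def C_def)
        fix p q assume "p \<in> R \<union> C" "q \<in> R \<union> C"
        then have "Mat \<tau> p q =
            (if p \<in> R \<and> q \<in> C then fmem \<sigma>1 ''coeff'' [i, snd p, snd q, fst p] else if p = q then 1 else 0)"
          using \<tau> by blast
        moreover have "fmem \<sigma>1 ''coeff'' [i, snd p, snd q, fst p] = ?A p q" if "p \<in> R" "q \<in> C"
          using 1 that unfolding R_def C_def by auto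
        ultimately show "Mat \<tau> p q = (if p \<in> R \<and> q \<in> C then ?A p q else if p = q then 1 else 0)"
          by (cases "p \<in> R \<and> q \<in> C") auto
      qed
      ultimately show "?Q2 \<tau>" using 1 by simp
    qed auto
    fix \<sigma>2 assume agr2: "agree level_vars \<sigma>2 \<sigma>1" and 2: "?Q2 \<sigma>2"
    have env2: "nmem \<sigma>2 ''n'' [] = n" "nmem \<sigma>2 ''s'' [] = s"
      using agr2 env1 by (simp_all add: agree_def)
    let ?Q3 = "\<lambda>\<tau>. nmem \<tau> ''off'' [] = i * s \<and> fmem \<tau> ''X'' = fmem \<sigma> ''X'' \<and> fmem \<tau> ''coeff'' = fmem \<sigma>1 ''coeff'' \<and> reduction R C ?A (Mat \<tau>) \<and>
      (\<forall>p\<in>R. \<forall>v\<in>C. Mat \<tau> p v = 0)"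
    show "runs level_vars (Seq reduce_matrix (Seq extend_functional (NAssign ''off'' [] column))) \<sigma>2
      (nest_time [n, s] (nest_time [s]
        (nest_time [n + 1, s] 1 + (nest_time [n + 1, s] 1 + nest_time [n + 1, s, n + 1, s] 1))) +
      (nest_time [n, s, s] 1 + 1)) (invariant (Suc i))"
    proof (rule runs_Seq)
      have "reduction R C ?A (Mat \<sigma>2)" using 2 by blast
      then show "runs level_vars reduce_matrix \<sigma>2 (nest_time [n, s] (nest_time [s]
          (nest_time [n + 1, s] 1 + (nest_time [n + 1, s] 1 + nest_time [n + 1, s, n + 1, s] 1)))) ?Q3"
        by (rule runs_weaken[OF runs_reduce_matrix[OF env2]]) (use 2 in \<open>simp_all add: agree_def\<close>)
      fix \<sigma>3 assume agr3: "agree level_vars \<sigma>3 \<sigma>2" and 3: "?Q3 \<sigma>3"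
      have env3: "nmem \<sigma>3 ''n'' [] = n" "nmem \<sigma>3 ''s'' [] = s" "nmem \<sigma>3 ''off'' [] = i * s"
        using agr3 env2 3 by (simp_all add: agree_def)
      let ?Q4 = "\<lambda>\<tau>. nmem \<tau> ''off'' [] = i * s \<and> fmem \<tau> ''coeff'' = fmem \<sigma>3 ''coeff'' \<and>
        (\<forall>t r c. Xf \<tau> t r c = (if t < n \<and> i * s \<le> r \<and> r < i * s + s \<and> i * s + s \<le> c \<and> c < i * s + s + s
          then - Mat \<sigma>3 (n, c - (i * s + s)) (t, r - i * s) else Xf \<sigma> t r c))"
      show "runs level_vars (Seq extend_functional (NAssign ''off'' [] column)) \<sigma>3
        (nest_time [n, s, s] 1 + 1) (invariant (Suc i))"
      proof (rule runs_Seq)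
        show "runs level_vars extend_functional \<sigma>3 (nest_time [n, s, s] 1) ?Q4"
          by (rule runs_weaken[OF runs_extend_functional[OF env3]]) (use 3 env3 in \<open>simp_all add: agree_def\<close>)
        fix \<tau> assume agr4: "agree level_vars \<tau> \<sigma>3" and 4: "?Q4 \<tau>"
        have X: "Xf \<tau> t r c = (if t < n \<and> i * s \<le> r \<and> r < i * s + s \<and> i * s + s \<le> c \<and> c < i * s + s + s
          then - Mat \<sigma>3 (n, c - (i * s + s)) (t, r - i * s) else Xf \<sigma> t r c)" for t r c
          using 4 by blast
        let ?\<tau> = "nupdate ''off'' [] (i * s + s) \<tau>"
        have coeff: "fmem \<tau> ''coeff'' = fmem \<sigma>1 ''coeff''" using 3 4 by simp
        have "invariant (Suc i) ?\<tau>"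
          unfolding invariant_def
        proof (intro conjI allI impI ballI)
          show "nmem ?\<tau> ''off'' [] = Suc i * s" by (simp add: nmem_nupdate)
          show "Xf ?\<tau> t r c = 0" if "c \<le> r \<or> Suc i * s + s \<le> c" for t r c
          proof -
            have "\<not> (t < n \<and> i * s \<le> r \<and> r < i * s + s \<and> i * s + s \<le> c \<and> c < i * s + s + s)"
              using that by auto
            then show ?thesis using X[of t r c] zero[of c r t] that by auto
          qed
          show "spanning (Xf ?\<tau>) P (Suc i)"
          \<comment> \<open>The new functional \<open>v\<close> takes its weights from row
            \<open>(n, v)\<close> of the reduced matrix.\<close>
          proof (rule spanning_Suc[where X = "Xf \<sigma>" and G = "\<lambda>v u t. - Mat \<sigma>3 (n, v) (t, u)"], unfold s[symmetric] n[symmetric])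
            show "spanning (Xf \<sigma>) P i" by (rule span)
            show "?m u v t = (\<Sum>u'<s. ?m u u' t * (\<Sum>u2<s. \<Sum>t2<n. - Mat \<sigma>3 (n, u') (t2, u2) * ?m u2 v t2))"
              if "u < s" "v < s" "t < n" for u v t
              by (rule generalized_inverse_R_C) (use 3 that in auto)
          qed (simp_all add: X zero)
          fix l w t v assume l: "l < Suc i" and w: "w \<in> words n l" and t: "t < n" and v: "v < s"
          show "gate_coeff P (Suc l) v (w @ [t]) = (\<Sum>u<s. gate_coeff P l u w * fmem ?\<tau> ''coeff'' [l, u, v, t])"
          proof (cases "l = i")
            case True
            have "(\<Sum>u<s. gate_coeff P i u w * ?m u v t) = (\<Sum>u<s. gate_coeff P i u w * fmem ?\<tau> ''coeff'' [i, u, v, t])"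
              using 1 t v by (intro sum.cong) (simp_all add: coeff)
            then show ?thesis
              using gate_coeff_eq_measured[OF span, of w t v] w t True by (simp add: n[symmetric] s[symmetric])
          next
            case False
            then show ?thesis
              using inv l w t v 1 by (simp add: invariant_def coeff)
          qed
        qed
        then show "runs level_vars (NAssign ''off'' [] column) \<tau> 1 (invariant (Suc i))"
          using agr4 env3 4 by (intro runs_NAssign) (simp_all add: agree_def)
      qed
    qed
  qed
qed

end

section \<open>Preparation and the whole program\<close>

context learner
begin

abbreviation output_ready :: "nat \<Rightarrow> 'a state \<Rightarrow> bool" where
  "output_ready d \<sigma> \<equiv> nmem \<sigma> ''depth'' [] = d \<and>
    (\<forall>i\<le>d. nmem \<sigma> ''width'' [i] = (if i = 0 \<or> i = d then 1 else s)) \<and>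
    (\<forall>i<d. \<forall>u<s. \<forall>v<s. nmem \<sigma> ''arc'' [i, u, v] = 1)"

lemma runs_prep:
  assumes env: "nmem \<sigma> ''n'' [] = n" "nmem \<sigma> ''d'' [] = d" "nmem \<sigma> ''s'' [] = s"
  shows "runs {''depth'', ''width'', ''arc'', ''i'', ''u'', ''v''} prep \<sigma> (prep_time d s)
    (\<lambda>\<tau>. fmem \<tau> = fmem \<sigma> \<and> output_ready d \<tau>)" (is "runs ?V _ _ _ _")
  unfolding prep_def prep_time_def
proof (rule runs_Seq)
  show "runs ?V (NAssign ''depth'' [] (nv ''d'')) \<sigma> 1 (\<lambda>\<tau>. fmem \<tau> = fmem \<sigma> \<and> nmem \<tau> ''depth'' [] = d)"
    by (rule runs_NAssign) (simp_all add: env nmem_nupdate)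
  fix \<sigma>1 assume agr1: "agree ?V \<sigma>1 \<sigma>" and 1: "fmem \<sigma>1 = fmem \<sigma> \<and> nmem \<sigma>1 ''depth'' [] = d"
  let ?Q2 = "\<lambda>\<tau>. fmem \<tau> = fmem \<sigma> \<and> nmem \<tau> ''depth'' [] = d \<and> (\<forall>i<d. nmem \<tau> ''width'' [i] = s)"
  let ?arcs = "nest [(''i'', nv ''d''), (''u'', nv ''s''), (''v'', nv ''s'')]
        (NAssign ''arc'' [nv ''i'', nv ''u'', nv ''v''] (NConst 1))"
  let ?Q = "\<lambda>\<tau>. fmem \<tau> = fmem \<sigma> \<and> output_ready d \<tau>"
  have env1: "nmem \<sigma>1 ''d'' [] = d" "nmem \<sigma>1 ''s'' [] = s"
    using agr1 env by (simp_all add: agree_def)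
  show "runs ?V (Seq (nest [(''i'', nv ''d'')] (NAssign ''width'' [nv ''i''] (nv ''s'')))
    (Seq (NAssign ''width'' [NConst 0] (NConst 1)) (Seq (NAssign ''width'' [nv ''d''] (NConst 1)) ?arcs))) \<sigma>1
    (nest_time [d] 1 + (1 + (1 + nest_time [d, s, s] 1))) ?Q"
  proof (rule runs_Seq)
    let ?l = "[(''i'', nv ''d'')]"
    let ?J = "\<lambda>S \<tau>. fmem \<tau> = fmem \<sigma> \<and> (\<forall>i. [i] \<in> S \<longrightarrow> nmem \<tau> ''width'' [i] = s)"
    have "runs (fst ` set ?l \<union> {''width''}) (nest ?l (NAssign ''width'' [nv ''i''] (nv ''s''))) \<sigma>1
      (nest_time [d] 1) (?J (tuples [d]))"
    proof (rule runs_nest[where J = ?J])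
      fix \<tau> ks S
      assume "agree (fst ` set ?l \<union> {''width''}) \<tau> \<sigma>1" "map (\<lambda>(x, e). nmem \<tau> x []) ?l = ks" "?J S \<tau>"
      then show "runs {''width''} (NAssign ''width'' [nv ''i''] (nv ''s'')) \<tau> 1 (?J (insert ks S))"
        using env1 by (intro runs_NAssign) (simp_all add: agree_def nmem_nupdate)
    qed (use env1 1 in \<open>simp_all add: agree_def nmem_nupdate\<close>)
    then show "runs ?V (nest ?l (NAssign ''width'' [nv ''i''] (nv ''s''))) \<sigma>1 (nest_time [d] 1) ?Q2"
      by (rule runs_weaken) (use 1 in \<open>simp_all add: agree_def tuples_iff\<close>)
    fix \<sigma>2 assume agr2: "agree ?V \<sigma>2 \<sigma>1" and 2: "?Q2 \<sigma>2"
    \<comment> \<open>Level \<open>d\<close> lies outside the loop and gets its width from the next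
      assignment; if \<open>d = 0\<close>, both single assignments hit the same cell.\<close>
    let ?Q3 = "\<lambda>\<tau>. fmem \<tau> = fmem \<sigma> \<and> nmem \<tau> ''depth'' [] = d \<and>
      (\<forall>i<d. nmem \<tau> ''width'' [i] = (if i = 0 then 1 else s))"
    show "runs ?V (Seq (NAssign ''width'' [NConst 0] (NConst 1)) (Seq (NAssign ''width'' [nv ''d''] (NConst 1)) ?arcs)) \<sigma>2
      (1 + (1 + nest_time [d, s, s] 1)) ?Q"
    proof (rule runs_Seq)
      show "runs ?V (NAssign ''width'' [NConst 0] (NConst 1)) \<sigma>2 1 ?Q3"
        by (rule runs_NAssign) (use 2 in \<open>simp_all add: nmem_nupdate\<close>)
      fix \<sigma>3 assume agr3: "agree ?V \<sigma>3 \<sigma>2" and 3: "?Q3 \<sigma>3"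
      have env3: "nmem \<sigma>3 ''d'' [] = d" "nmem \<sigma>3 ''s'' [] = s"
        using agr3 agr2 env1 by (simp_all add: agree_def)
      let ?Q4 = "\<lambda>\<tau>. fmem \<tau> = fmem \<sigma> \<and> nmem \<tau> ''depth'' [] = d \<and>
        (\<forall>i\<le>d. nmem \<tau> ''width'' [i] = (if i = 0 \<or> i = d then 1 else s))"
      show "runs ?V (Seq (NAssign ''width'' [nv ''d''] (NConst 1)) ?arcs) \<sigma>3 (1 + nest_time [d, s, s] 1) ?Q"
      proof (rule runs_Seq)
        show "runs ?V (NAssign ''width'' [nv ''d''] (NConst 1)) \<sigma>3 1 ?Q4"
          by (rule runs_NAssign) (use 3 env3 in \<open>simp_all add: nmem_nupdate\<close>)
        fix \<sigma>4 assume agr4: "agree ?V \<sigma>4 \<sigma>3" and 4: "?Q4 \<sigma>4"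
        have env4: "nmem \<sigma>4 ''d'' [] = d" "nmem \<sigma>4 ''s'' [] = s"
          using agr4 env3 by (simp_all add: agree_def)
        let ?l = "[(''i'', nv ''d''), (''u'', nv ''s''), (''v'', nv ''s'')]"
        let ?J = "\<lambda>S \<tau>. fmem \<tau> = fmem \<sigma> \<and> (\<forall>ks\<in>S. nmem \<tau> ''arc'' ks = 1)"
        have "runs (fst ` set ?l \<union> {''arc''}) ?arcs \<sigma>4 (nest_time [d, s, s] 1) (?J (tuples [d, s, s]))"
        proof (rule runs_nest[where J = ?J])
          fix \<tau> :: "'a state" and ks S
          assume "map (\<lambda>(x, e). nmem \<tau> x []) ?l = ks" "?J S \<tau>"
          then show "runs {''arc''} (NAssign ''arc'' [nv ''i'', nv ''u'', nv ''v''] (NConst 1)) \<tau> 1 (?J (insert ks S))"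
            by (intro runs_NAssign) (simp_all add: nmem_nupdate)
        qed (use env4 4 in \<open>auto simp: agree_def nmem_nupdate\<close>)
        then show "runs ?V ?arcs \<sigma>4 (nest_time [d, s, s] 1) ?Q"
          by (rule runs_weaken) (use 4 in \<open>simp_all add: agree_def tuples_iff\<close>)
      qed
    qed
  qed
qed

lemma runs_learn:
  fixes d N T :: nat
  defines "\<sigma>0 \<equiv> initial_state n d s"
  assumes d: "d = abp_depth P"
    and K: "Suc (d * s) \<le> K" and T: "\<And>k. k \<le> Suc (d * s) \<Longrightarrow> cost k \<le> T"
  shows "runs UNIV learn \<sigma>0 (learn_time n d s T)
    (\<lambda>\<sigma>. is_abp (output_abp n \<sigma>) \<and> abp_poly (output_abp n \<sigma>) = abp_poly P)"
  unfolding learn_def learn_time_def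
proof (rule runs_Seq)
  let ?V = "{''depth'', ''width'', ''arc'', ''i'', ''u'', ''v''}"
  have env0: "nmem \<sigma>0 ''n'' [] = n" "nmem \<sigma>0 ''d'' [] = d" "nmem \<sigma>0 ''s'' [] = s"
    "nmem \<sigma>0 ''off'' [] = 0" "fmem \<sigma>0 = (\<lambda>x is. 0)"
    by (simp_all add: \<sigma>0_def initial_state_def)
  let ?Q = "\<lambda>\<tau>. agree ?V \<tau> \<sigma>0 \<and> fmem \<tau> = fmem \<sigma>0 \<and> output_ready d \<tau>"
  show "runs UNIV prep \<sigma>0 (prep_time d s) ?Q"
    by (rule runs_weaken[OF runs_prep[OF env0(1-3)]]) simp_all
  fix \<sigma>1 assume 1: "?Q \<sigma>1"
  have env1: "nmem \<sigma>1 ''n'' [] = n" "nmem \<sigma>1 ''d'' [] = d" "nmem \<sigma>1 ''s'' [] = s"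
    "nmem \<sigma>1 ''off'' [] = 0" "fmem \<sigma>1 = (\<lambda>x is. 0)"
    using 1 env0 by (simp_all add: agree_def)
  have "runs (insert ''i'' level_vars) (nest [(''i'', nv ''d'')] level) \<sigma>1 (d * (level_time n s T + 2) + 2) (invariant d)"
  proof (rule runs_for)
    show "nval \<tau> (nv ''d'') = d" if "agree (insert ''i'' level_vars) \<tau> \<sigma>1" for \<tau>
      using that env1 by (simp add: agree_def)
    have "spanning (\<lambda>t r c. 0) P 0"
      using spanning_0 size_pos by blast
    then show "invariant 0 (nupdate ''i'' [] 0 \<sigma>1)"
      using env1 by (simp add: invariant_def nmem_nupdate)
    fix k \<tau>
    assume k: "k < d" "agree (insert ''i'' level_vars) \<tau> \<sigma>1" "nmem \<tau> ''i'' [] = k" "invariant k \<tau>"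
    have env: "nmem \<tau> ''n'' [] = n" "nmem \<tau> ''s'' [] = s"
      using k(2) env1 by (simp_all add: agree_def)
    \<comment> \<open>Level \<open>k < d\<close> queries in dimension \<open>k * s + s + 1\<close>,
      so \<open>d * s + 1\<close> suffices throughout.\<close>
    have "Suc k * s \<le> d * s" using k(1) by (intro mult_le_mono1) simp
    then have le: "Suc (k * s + s) \<le> Suc (d * s)" by (simp add: add.commute)
    have "runs level_vars level \<tau> (level_time n s T) (invariant (Suc k))"
      by (rule runs_level[OF env k(3,4)]) (use le K T in \<open>auto intro: le_trans\<close>)
    then show "runs level_vars (nest [] level) \<tau> (level_time n s T) (\<lambda>\<upsilon>. invariant (Suc k) (nupdate ''i'' [] (Suc k) \<upsilon>))"
      by (auto simp: invariant_def nmem_nupdate elim!: runs_weaken)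
  qed simp
  then show "runs UNIV (nest [(''i'', nv ''d'')] level) \<sigma>1 (d * (level_time n s T + 2) + 2)
    (\<lambda>\<sigma>. is_abp (output_abp n \<sigma>) \<and> abp_poly (output_abp n \<sigma>) = abp_poly P)"
  proof (rule runs_weaken)
    fix \<tau> assume agr: "agree (insert ''i'' level_vars) \<tau> \<sigma>1" and inv: "invariant d \<tau>"
    have out: "output_ready d \<tau>" using 1 agr by (simp add: agree_def)
    show "is_abp (output_abp n \<tau>) \<and> abp_poly (output_abp n \<tau>) = abp_poly P"
    proof
      have depth: "nmem \<tau> ''depth'' [] = d"
        and width: "\<And>i. i \<le> d \<Longrightarrow> nmem \<tau> ''width'' [i] = (if i = 0 \<or> i = d then 1 else s)"
        and arc: "\<And>i u v. i < d \<Longrightarrow> u < s \<Longrightarrow> v < s \<Longrightarrow> nmem \<tau> ''arc'' [i, u, v] = 1"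
        using out by simp_all
      have coeff: "gate_coeff P (Suc i) v (w @ [t]) = (\<Sum>u<s. gate_coeff P i u w * fmem \<tau> ''coeff'' [i, u, v, t])"
        if "i < d" "w \<in> words n i" "t < n" "v < s" for i w t v
        using inv that by (simp add: invariant_def)
      note correct = output_abp_correct[of \<tau>, folded n s d, OF depth width arc coeff]
      show "is_abp (output_abp n \<tau>)" by (rule correct(1))
      show "abp_poly (output_abp n \<tau>) = abp_poly P" by (rule correct(2))
    qed
  qed simp_all
qed

end

theorem theorem6:
  shows "\<exists>(prog :: com) (K :: nat poly). \<forall>cost :: nat poly. \<exists>time :: nat poly.
    \<forall>(P :: 'a::field abp) n d s.
      is_abp P \<and> abp_nvars P = n \<and> abp_depth P = d \<and> abp_size P = s \<longrightarrow>
      (\<exists>t \<sigma>. exec (blackbox_of P) (poly K (d + s + n)) (poly cost) prog (initial_state n d s) t \<sigma> \<and>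
             t \<le> poly time (d + s + n) \<and>
             is_abp (output_abp n \<sigma>) \<and>
             abp_poly (output_abp n \<sigma>) = abp_poly P)"
\<comment> \<open>The polynomial is \<open>1 + N^2\<close>; with \<open>N = d + s + n\<close> it
  bounds the largest dimension \<open>d * s + 1\<close>.\<close>
proof (rule exI[of _ learn], rule exI[of _ "[:1, 0, 1:] :: nat poly"], rule allI)
  fix cost :: "nat poly"
  let ?K = "[:1, 0, 1:] :: nat poly" and ?x = "[:0, 1:] :: nat poly"
  \<comment> \<open>Each of \<open>n\<close>, \<open>d\<close>, \<open>s\<close> is replaced by the
    larger \<open>N\<close>, and each query is charged at the maximal dimension.\<close>
  let ?time = "learn_time ?x ?x ?x (pcompose cost ?K)"
  show "\<exists>time :: nat poly. \<forall>(P :: 'a abp) n d s.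
      is_abp P \<and> abp_nvars P = n \<and> abp_depth P = d \<and> abp_size P = s \<longrightarrow>
      (\<exists>t \<sigma>. exec (blackbox_of P) (poly ?K (d + s + n)) (poly cost) learn (initial_state n d s) t \<sigma> \<and>
             t \<le> poly time (d + s + n) \<and>
             is_abp (output_abp n \<sigma>) \<and>
             abp_poly (output_abp n \<sigma>) = abp_poly P)"
  proof (intro exI[of _ ?time] allI impI)
    fix P :: "'a abp" and n d s :: nat
    assume P: "is_abp P \<and> abp_nvars P = n \<and> abp_depth P = d \<and> abp_size P = s"
    let ?N = "d + s + n"
    interpret learner P "poly ?K ?N" "poly cost" n s
      by unfold_locales (use P in auto)
    have "d * s \<le> ?N * ?N" by (intro mult_le_mono) simp_all
    then have K: "Suc (d * s) \<le> poly ?K ?N" by simp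
    \<comment> \<open>Polynomials with natural coefficients are monotone.\<close>
    have "poly cost k \<le> poly cost (poly ?K ?N)" if "k \<le> Suc (d * s)" for k
      using that K by (intro poly_nat_mono) (rule le_trans)
    then have "runs UNIV learn (initial_state n d s) (learn_time n d s (poly cost (poly ?K ?N)))
      (\<lambda>\<sigma>. is_abp (output_abp n \<sigma>) \<and> abp_poly (output_abp n \<sigma>) = abp_poly P)"
      using P K by (intro runs_learn) simp_all
    moreover have "learn_time n d s (poly cost (poly ?K ?N)) \<le> poly ?time ?N"
      unfolding poly_learn_time poly_pcompose by (rule learn_time_mono) simp_all
    ultimately show "\<exists>t \<sigma>. exec (blackbox_of P) (poly ?K ?N) (poly cost) learn (initial_state n d s) t \<sigma> \<and>
        t \<le> poly ?time ?N \<and> is_abp (output_abp n \<sigma>) \<and> abp_poly (output_abp n \<sigma>) = abp_poly P"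
      unfolding runs_def by (meson le_trans)
  qed
qed

end
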